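(* Let $E\subset\mathbb{R}^2$ be an open, bounded set with smooth boundary which is weakly $1$-semiconvex and is not $1$-semiconvex. Then $E$ consists of at least four components.
   Context: In the plane, a $1$-dimensional half-plane is a ray (closed half-line). A set $E\subset\mathbb{R}^2$ is called $1$-semiconvex with respect to a point $x\in\mathbb{R}^2\setminus E$ if there exists a ray $L$ such that $x\in L$ and $L\cap E=\emptyset$ (equivalently, there is a ray starting at $x$ that does not meet $E$). A set $E\subset\mathbb{R}^2$ is called $1$-semiconvex if it is $1$-semiconvex with respect to every point $x\in\mathbb{R}^2\setminus E$. An open set $G\subset\mathbb{R}^2$ is called weakly $1$-semiconvex if it is $1$-semiconvex with respect to every point $x\in\partial G$, where $\partial G=\overline{G}\setminus\mathrm{Int}\,G$. The components of a nonempty set are its maximal connected subsets. "Smooth boundary" is understood in the standard sense. *)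

theory Defs
  imports "HOL-Analysis.Analysis"
begin

definition is_ray :: "(real^2) set \<Rightarrow> bool" where
  "is_ray L \<longleftrightarrow> (\<exists>a v. v \<noteq> 0 \<and> L = {a + t *\<^sub>R v | t. 0 \<le> t})"

definition semiconvex_at :: "(real^2) set \<Rightarrow> real^2 \<Rightarrow> bool" where
  "semiconvex_at E x \<longleftrightarrow> (\<exists>L. is_ray L \<and> x \<in> L \<and> L \<inter> E = {})"

definition semiconvex :: "(real^2) set \<Rightarrow> bool" where
  "semiconvex E \<longleftrightarrow> (\<forall>x. x \<notin> E \<longrightarrow> semiconvex_at E x)"

definition weakly_semiconvex :: "(real^2) set \<Rightarrow> bool" where
  "weakly_semiconvex G \<longleftrightarrow> open G \<and> (\<forall>x\<in>frontier G. semiconvex_at G x)"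

text \<open>
  Smoothness of the boundary is taken in the sense of class C1, the weakest standard
  reading: near each boundary point, the set is the strict sublevel set of a continuously
  differentiable function \<open>\<phi>\<close> whose gradient \<open>g\<close> does not vanish. In particular the set lies
  locally on one side of its boundary curve.
\<close>

definition smooth_boundary :: "(real^2) set \<Rightarrow> bool" where
  "smooth_boundary E \<longleftrightarrow>
     (\<forall>p\<in>frontier E. \<exists>U (\<phi> :: real^2 \<Rightarrow> real) (g :: real^2 \<Rightarrow> real^2).
        open U \<and> p \<in> U \<and>
        (\<forall>x\<in>U. (\<phi> has_derivative (\<lambda>h. g x \<bullet> h)) (at x)) \<and>
        continuous_on U g \<and> (\<forall>x\<in>U. g x \<noteq> 0) \<and>
        E \<inter> U = {x \<in> U. \<phi> x < 0})"

end

theory Submission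
  imports Defs
begin

text \<open>
  Call a point outside \<open>E\<close> dark if every ray from it meets \<open>E\<close>. A set that is not semiconvex has a
  dark point, and weak semiconvexity keeps dark points off the frontier. Put a dark point at the
  origin of the complex plane. For every angle \<open>s\<close> let \<open>hit s\<close> be the first point of the closure of
  \<open>E\<close> on the ray at angle \<open>s\<close>. It is a frontier point, so some ray from it avoids \<open>E\<close>. This free
  ray neither continues the line of sight nor runs back along it, since the origin is dark; hence
  it turns left or right by less than a half turn.

  The segment from the origin to \<open>hit s\<close> followed by the free ray is a curve from the origin to
  infinity that avoids \<open>E\<close>. Such a cut makes the argument single-valued on \<open>E\<close>. Lift the
  components of \<open>E\<close> to the universal cover of the punctured plane; call the lifts sheets. The
  lifted cut separates the sheets. Suppose that the free ray turns left. Smoothness says that \<open>E\<close>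
  is, to first order, a half-plane at \<open>hit s\<close>, and this half-plane contains neither the direction
  towards the origin nor that of the free ray; so the sheet seen at \<open>s\<close> lies to the right of the
  cut (lemma \<open>behind_front\<close>). Whatever is hidden by a sheet to the right of the cut is again to
  the right of it (\<open>behind_hidden\<close>), and a sheet to the right of the cut stays below the angle
  \<open>s + pi\<close> (\<open>behind_bound\<close>). So at every angle either all sheets that are directly or indirectly
  hidden by the front sheet lie below \<open>s + pi\<close>, or all of them lie above \<open>s - pi\<close>
  (\<open>turn_leans\<close>). Where the front passes from one sheet to another, the line of sight is tangent to
  \<open>E\<close>, and the side on which \<open>E\<close> lies decides which alternative holds (\<open>tangent_at_edge\<close>).

  What remains is combinatorics of the relation \<open>hides\<close> between sheets, on which the rotation
  by \<open>2 * pi\<close> acts with one orbit for each component (locale \<open>layered_views\<close>). Going up from an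
  angle that leans left, one must leave the sheets hidden by the front, and the first sheet outside
  hides one of them and leans right (\<open>exit_reach\<close>). On the other hand, sheets that lean both ways
  cannot hide two different copies of one component (\<open>opposite_leans\<close>). If one component hides,
  directly or indirectly, a copy of every other one, these facts contradict each other
  (\<open>no_dominating_orbit\<close>). Otherwise fewer than four components can only be two unrelated ones
  that both hide a third; but then, going up from the last angle at which the first is seen, one
  meets the second and after it the same copy of the first again (\<open>no_two_tops_one_bottom\<close>). Hence
  there are at least four.
\<close>

section \<open>Layered views of a circle\<close>

text \<open>
  \<open>front s\<close> is the layer seen at angle \<open>s\<close> and \<open>cov K\<close> the set of angles at which the layer \<open>K\<close>
  is present, so a layer hides those that are present where it is seen.
\<close>

definition hides :: "('l \<Rightarrow> real set) \<Rightarrow> (real \<Rightarrow> 'l) \<Rightarrow> 'l \<Rightarrow> 'l \<Rightarrow> bool" where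
  "hides cov front J K \<longleftrightarrow> (\<exists>s. front s = J \<and> s \<in> cov K)"

text \<open>
  The sign \<open>\<sigma>\<close> is \<open>1\<close> for a free ray that turns left and \<open>- 1\<close> for one that turns right. Whatever is
  directly or indirectly hidden at \<open>s\<close> stays behind this ray, which turns by less than \<open>pi\<close>.
\<close>

definition leans :: "('l \<Rightarrow> real set) \<Rightarrow> (real \<Rightarrow> 'l) \<Rightarrow> real \<Rightarrow> real \<Rightarrow> bool" where
  "leans cov front \<sigma> s \<longleftrightarrow> (\<forall>K t. (hides cov front)\<^sup>*\<^sup>* (front s) K \<longrightarrow> t \<in> cov K \<longrightarrow> \<sigma> * (t - s) < pi)"

text \<open>
  Layers are pairs of a component and an integer that names its lift; adding \<open>m\<close> to the integer
  moves a layer \<open>m\<close> full turns up. The last assumption is the trace of smoothness: where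
  another layer takes over the front on the \<open>\<sigma>\<close> side of \<open>s\<close>, the view leans to that side.
\<close>

locale layered_views =
  fixes X :: "'x set" and cov :: "'x \<times> int \<Rightarrow> real set" and front :: "real \<Rightarrow> 'x \<times> int"
  assumes finite_X: "finite X"
    and cov_nonempty: "cov (x, k) \<noteq> {} \<longleftrightarrow> x \<in> X"
    and cov_shift: "t + 2 * pi * of_int m \<in> cov (x, k + m) \<longleftrightarrow> t \<in> cov (x, k)"
    and cov_connected: "connected (cov K)"
    and cov_compact: "compact (cov K)"
    and front_shift: "front (s + 2 * pi * of_int m) = (fst (front s), snd (front s) + m)"
    and front_cov: "s \<in> cov (front s)"
    and leans_cases: "leans cov front 1 s \<or> leans cov front (- 1) s"
    and leans_at_edge: "\<lbrakk>\<sigma> \<in> {1, - 1}; K \<noteq> front s; \<And>\<epsilon>. \<epsilon> > 0 \<Longrightarrow> \<exists>u. 0 < u \<and> u < \<epsilon> \<and> front (s + \<sigma> * u) = K\<rbrakk>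
           \<Longrightarrow> leans cov front \<sigma> s"
begin

abbreviation "hid \<equiv> hides cov front"
abbreviation "reach J K \<equiv> (hides cov front)\<^sup>*\<^sup>* J K"
abbreviation "lean \<equiv> leans cov front"

lemma hid_covers: "s \<in> cov K \<Longrightarrow> hid (front s) K"
  unfolding hides_def by blast

lemma leanD: "lean \<sigma> s \<Longrightarrow> reach (front s) K \<Longrightarrow> t \<in> cov K \<Longrightarrow> \<sigma> * (t - s) < pi"
  unfolding leans_def by blast

lemma fst_front: "fst (front s) \<in> X"
  using front_cov[of s] cov_nonempty[of "fst (front s)" "snd (front s)"] by auto

lemma cov_fst: "t \<in> cov K \<Longrightarrow> fst K \<in> X"
  using cov_nonempty[of "fst K" "snd K"] by auto

lemma hid_shift:
  assumes "hid (x, k) (y, l)" shows "hid (x, k + m) (y, l + m)"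
proof -
  obtain s where "front s = (x, k)" "s \<in> cov (y, l)" using assms unfolding hides_def by blast
  then have "front (s + 2 * pi * of_int m) = (x, k + m)" "s + 2 * pi * of_int m \<in> cov (y, l + m)"
    using front_shift cov_shift by auto
  then show ?thesis unfolding hides_def by blast
qed

lemma reach_shift:
  assumes "reach (x, k) (y, l)" shows "reach (x, k + m) (y, l + m)"
proof -
  have "reach (fst J, snd J + m) (fst K, snd K + m)" if "reach J K" for J K
    using that
  proof induction
    case (step K L)
    then show ?case
      using hid_shift[of "fst K" "snd K" "fst L" "snd L" m] by (auto intro: rtranclp.rtrancl_into_rtrancl)
  qed auto
  from this[OF assms] show ?thesis by simp
qed

lemma lean_shift:
  assumes "lean \<sigma> s" shows "lean \<sigma> (s + 2 * pi * of_int m)"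
  unfolding leans_def
proof (intro allI impI)
  fix K t assume r: "reach (front (s + 2 * pi * of_int m)) K" and t: "t \<in> cov K"
  obtain y l where K: "K = (y, l)" by force
  have "reach (front s) (y, l - m)"
    using reach_shift[of "fst (front s)" "snd (front s) + m" y l "- m"] r K front_shift by simp
  moreover have "t - 2 * pi * of_int m \<in> cov (y, l - m)"
    using cov_shift[of t "- m" y l] t K by simp
  ultimately show "\<sigma> * (t - (s + 2 * pi * of_int m)) < pi"
    using leanD[OF assms] by (metis diff_diff_eq add.commute)
qed

lemma reach_fst:
  assumes "reach J K" "fst J \<in> X" shows "fst K \<in> X"
  using assms by induction (auto simp: hides_def dest: cov_fst)

lemma cov_between:
  assumes "a \<in> cov K" "b \<in> cov K" "t \<in> closed_segment a b" shows "t \<in> cov K"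
  using assms cov_connected[of K] is_interval_connected_1 is_interval_convex_1 convex_contains_segment by blast

text \<open>
  Hiding layers share an angle, so the layers along a chain from \<open>J\<close> to \<open>K\<close> together cover an
  interval.
\<close>

lemma reach_between:
  assumes "reach J K" "a \<in> cov J" "b \<in> cov K" "t \<in> closed_segment a b"
  shows "\<exists>M. reach J M \<and> reach M K \<and> t \<in> cov M"
  using assms
proof (induction arbitrary: a rule: converse_rtranclp_induct)
  case base
  then show ?case using cov_between by blast
next
  case (step J M)
  obtain s where s: "front s = J" "s \<in> cov M" using step.hyps(1) unfolding hides_def by blast
  have sJ: "s \<in> cov J" using front_cov[of s] s by simp
  have "t \<in> closed_segment a s \<or> t \<in> closed_segment s b"
    using step.prems by (auto simp: closed_segment_eq_real_ivl split: if_splits)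
  then show ?case
  proof
    assume "t \<in> closed_segment a s"
    then have "t \<in> cov J" using cov_between step.prems(1) sJ by blast
    then show ?thesis using step.hyps by (meson converse_rtranclp_into_rtranclp rtranclp.rtrancl_refl)
  next
    assume "t \<in> closed_segment s b"
    then show ?thesis using step.IH[OF s(2) step.prems(2)] step.hyps(1)
      by (meson converse_rtranclp_into_rtranclp)
  qed
qed

text \<open>
  Let \<open>a\<close> be an angle of the lower of the two copies of \<open>y\<close>. At an angle that leans left and
  reaches both copies, the upper copy forces the angle above \<open>a + pi\<close>; at one that leans right,
  the lower copy forces it below \<open>a + pi\<close>. So \<open>a + pi\<close> separates the two given angles, hence lies
  in a layer of the chain between them, and then it can lean neither way.
\<close>

lemma opposite_leans:
  assumes J12: "reach (front s1) (front s2)" and l1: "lean \<sigma> s1" and l2: "lean (- \<sigma>) s2" and s: "\<sigma> \<in> {1, - 1}"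
    and K: "reach (front s2) (y, k)" "reach (front s2) (y, l)" and "k \<noteq> l"
  shows False
proof -
  have *: False if kl: "k < l" and K: "reach (front s2) (y, k)" "reach (front s2) (y, l)" for k l
  proof -
    have "y \<in> X" using reach_fst[OF K(1) fst_front] by simp
    then obtain a where a: "a \<in> cov (y, k)" using cov_nonempty by blast
    define m where "m = l - k"
    have m: "m \<ge> 1" using kl m_def by simp
    define w where "w = 2 * pi * real_of_int m"
    have al: "a + w \<in> cov (y, l)" using cov_shift[of a m y k] a m_def w_def by simp
    have m2: "w \<ge> 2 * pi" using m by (simp add: w_def)
    have pl: "t > a + pi" if "lean 1 t" "reach (front t) (y, l)" for t
    proof -
      have "a + w - t < pi" using leanD[OF that al] by simp
      then show ?thesis using m2 by linarith
    qed
    have mi: "t < a + pi" if "lean (- 1) t" "reach (front t) (y, k)" for t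
    proof -
      have "t - a < pi" using leanD[OF that a] by simp
      then show ?thesis by linarith
    qed
    have r1: "reach (front s1) (y, k)" "reach (front s1) (y, l)" using J12 K by auto
    have seg: "a + pi \<in> closed_segment s1 s2"
      using s pl[of s1] mi[of s1] pl[of s2] mi[of s2] l1 l2 r1 K
      by (auto simp: closed_segment_eq_real_ivl)
    obtain M where M: "reach M (front s2)" "a + pi \<in> cov M"
      using reach_between[OF J12 front_cov front_cov seg] by blast
    have r: "reach (front (a + pi)) (front s2)" using hid_covers[OF M(2)] M(1) by (rule converse_rtranclp_into_rtranclp)
    have "reach (front (a + pi)) (y, k)" "reach (front (a + pi)) (y, l)" using r K by auto
    then show False using pl[of "a + pi"] mi[of "a + pi"] leans_cases[of "a + pi"] by auto
  qed
  show False using *[of k l] *[of l k] K \<open>k \<noteq> l\<close> by linarith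
qed

text \<open>
  If the lifts differ by \<open>m\<close> full turns, then periodicity makes one of them present \<open>m\<close> turns above
  the angle where they meet and the other one \<open>m\<close> turns below it, which excludes both leans.
\<close>

lemma no_self_hiding:
  assumes "hid (y, k) (y, l)" shows "k = l"
proof (rule ccontr)
  assume ne: "k \<noteq> l"
  obtain s where s: "front s = (y, k)" "s \<in> cov (y, l)" using assms unfolding hides_def by blast
  define m where "m = l - k"
  have s': "s \<in> cov (y, k)" using front_cov[of s] s by simp
  define w where "w = 2 * pi * real_of_int m"
  have 1: "s + w \<in> cov (y, l)" using cov_shift[of s m y k] s' m_def w_def by simp
  have "s + 2 * pi * of_int (- m) \<in> cov (y, l + - m)" using cov_shift s by blast
  moreover have "l + - m = k" "s + 2 * pi * of_int (- m) = s - w" by (simp_all add: m_def w_def algebra_simps)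
  ultimately have 2: "s - w \<in> cov (y, k)" by metis
  have r: "reach (front s) (y, l)" "reach (front s) (y, k)" using assms s by auto
  have "\<bar>w\<bar> < pi"
    using leans_cases[of s]
  proof
    assume l: "lean 1 s"
    show ?thesis using leanD[OF l r(1) 1] leanD[OF l r(2) 2] by (simp add: abs_less_iff)
  next
    assume l: "lean (- 1) s"
    show ?thesis using leanD[OF l r(1) 1] leanD[OF l r(2) 2] by (simp add: abs_less_iff)
  qed
  moreover have "\<bar>real_of_int m\<bar> \<ge> 1" using ne m_def by linarith
  then have "\<bar>w\<bar> \<ge> 2 * pi" by (simp add: w_def abs_mult)
  ultimately show False using pi_gt_zero by linarith
qed

text \<open>
  By this finiteness, what is seen at angles arbitrarily close to \<open>s\<close> on one side may be assumed to be
  a single layer.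
\<close>

lemma finite_front_values: "finite (front ` {a..b})"
proof -
  have "\<exists>B. \<forall>t\<in>cov (x, 0). \<bar>t\<bar> \<le> B" for x
    using compact_imp_bounded[OF cov_compact[of "(x, 0)"]] unfolding bounded_iff by auto
  then obtain B where B: "\<And>x t. t \<in> cov (x, 0) \<Longrightarrow> \<bar>t\<bar> \<le> B x" by metis
  have B': "\<bar>t\<bar> \<le> (\<Sum>x\<in>X. \<bar>B x\<bar>)" if "x \<in> X" "t \<in> cov (x, 0)" for x t
    using B[OF that(2)] member_le_sum[OF that(1), of "\<lambda>x. \<bar>B x\<bar>"] finite_X by force
  define C where "C = (\<Sum>x\<in>X. \<bar>B x\<bar>) + \<bar>a\<bar> + \<bar>b\<bar>"
  have "front s \<in> X \<times> {- \<lceil>C\<rceil>..\<lceil>C\<rceil>}" if "s \<in> {a..b}" for s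
  proof -
    obtain x k where xk: "front s = (x, k)" by force
    have x: "x \<in> X" using fst_front[of s] xk by simp
    have "s - 2 * pi * of_int k \<in> cov (x, 0)"
      using cov_shift[of s "-k" x k] front_cov[of s] xk by simp
    from B'[OF x this] that have "\<bar>2 * pi * real_of_int k\<bar> \<le> C" unfolding C_def by auto
    moreover have "\<bar>real_of_int k\<bar> \<le> \<bar>2 * pi * real_of_int k\<bar>"
      using pi_gt3 by (simp add: abs_mult mult_le_cancel_right1)
    ultimately have "\<bar>real_of_int k\<bar> \<le> C" by linarith
    then have "k \<in> {- \<lceil>C\<rceil>..\<lceil>C\<rceil>}" by (simp add: abs_le_iff) linarith
    then show ?thesis using x xk by simp
  qed
  then have "front ` {a..b} \<subseteq> X \<times> {- \<lceil>C\<rceil>..\<lceil>C\<rceil>}" by blast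
  then show ?thesis using finite_X finite_subset by blast
qed

lemma front_limit:
  assumes s: "\<sigma> \<in> {1, - 1}" and Q: "\<And>\<epsilon>. \<epsilon> > 0 \<Longrightarrow> \<exists>u. 0 < u \<and> u < \<epsilon> \<and> Q (front (s + \<sigma> * u))"
  obtains K where "Q K" "s \<in> cov K" "\<And>\<epsilon>. \<epsilon> > 0 \<Longrightarrow> \<exists>u. 0 < u \<and> u < \<epsilon> \<and> front (s + \<sigma> * u) = K"
proof -
  let ?V = "{K \<in> front ` {s - 1..s + 1}. Q K}"
  have fin: "finite ?V" using finite_front_values by simp
  have "\<exists>K\<in>?V. \<forall>\<epsilon>>0. \<exists>u. 0 < u \<and> u < \<epsilon> \<and> front (s + \<sigma> * u) = K"
  proof (rule ccontr)
    assume "\<not> ?thesis"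
    then have "\<forall>K\<in>?V. \<exists>\<epsilon>>0. \<forall>u. 0 < u \<and> u < \<epsilon> \<longrightarrow> front (s + \<sigma> * u) \<noteq> K" by blast
    then obtain e where e: "\<And>K. K \<in> ?V \<Longrightarrow> e K > 0 \<and> (\<forall>u. 0 < u \<and> u < e K \<longrightarrow> front (s + \<sigma> * u) \<noteq> K)"
      by metis
    define d where "d = Min (insert 1 (e ` ?V))"
    have d: "d > 0" "d \<le> 1" "\<And>K. K \<in> ?V \<Longrightarrow> d \<le> e K"
      using fin e by (auto simp: d_def)
    obtain u where u: "0 < u" "u < d" "Q (front (s + \<sigma> * u))" using Q[OF d(1)] by blast
    have "s + \<sigma> * u \<in> {s - 1..s + 1}" using s u d by auto
    then have V: "front (s + \<sigma> * u) \<in> ?V" using u by blast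
    then have "u < e (front (s + \<sigma> * u))" using d(3)[OF V] u by linarith
    then show False using e[OF V] u by blast
  qed
  then obtain K where K: "Q K" "\<And>\<epsilon>. \<epsilon> > 0 \<Longrightarrow> \<exists>u. 0 < u \<and> u < \<epsilon> \<and> front (s + \<sigma> * u) = K" by blast
  have "s \<in> closure (cov K)"
    unfolding closure_approachable
  proof (intro allI impI)
    fix \<epsilon> :: real assume "\<epsilon> > 0"
    then obtain u where "0 < u" "u < \<epsilon>" "front (s + \<sigma> * u) = K" using K(2) by blast
    then have "s + \<sigma> * u \<in> cov K" "dist (s + \<sigma> * u) s < \<epsilon>"
      using front_cov[of "s + \<sigma> * u"] s by (auto simp: dist_real_def)
    then show "\<exists>y\<in>cov K. dist y s < \<epsilon>" by blast
  qed
  then have "s \<in> cov K" using compact_imp_closed[OF cov_compact] by simp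
  then show thesis using that K by blast
qed

text \<open>
  Move from \<open>s\<close> in the direction \<open>\<sigma>\<close> to the supremum of the angles whose front is in \<open>C\<close>. The front
  there is outside \<open>C\<close>: otherwise it would hide a layer outside \<open>C\<close> that is seen arbitrarily soon
  afterwards. So it takes over from a layer of \<open>C\<close>, which it hides and which forces the lean.
\<close>

lemma exit_hidden_set:
  assumes s: "\<sigma> \<in> {1, - 1}"
    and closed: "\<And>J K. J \<in> C \<Longrightarrow> hid J K \<Longrightarrow> K \<in> C"
    and start: "front s \<in> C" and T: "T > 0" "front (s + \<sigma> * T) \<notin> C"
  obtains u J where "0 < u" "front (s + \<sigma> * u) \<notin> C" "J \<in> C" "hid (front (s + \<sigma> * u)) J" "lean (- \<sigma>) (s + \<sigma> * u)"
proof -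
  define A where "A = {u \<in> {0..T}. front (s + \<sigma> * u) \<in> C}"
  have A: "0 \<in> A" "bdd_above A" "A \<subseteq> {0..T}" using start T by (auto simp: A_def)
  define u where "u = Sup A"
  have u: "0 \<le> u" "u \<le> T" unfolding u_def using A by (auto intro!: cSup_upper cSup_least)
  have out: "front (s + \<sigma> * u) \<notin> C"
  proof
    assume inC: "front (s + \<sigma> * u) \<in> C"
    then have "u < T" using T u by (cases "u = T") auto
    have "\<exists>v. 0 < v \<and> v < \<epsilon> \<and> front (s + \<sigma> * u + \<sigma> * v) \<notin> C" if "\<epsilon> > 0" for \<epsilon>
    proof -
      define v where "v = min (\<epsilon> / 2) (T - u)"
      have v: "0 < v" "v < \<epsilon>" "u + v \<le> T" using that \<open>u < T\<close> by (auto simp: v_def)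
      have "u + v \<notin> A" using cSup_upper[of "u + v" A] A v u_def by auto
      then have "front (s + \<sigma> * (u + v)) \<notin> C" using v u by (auto simp: A_def)
      then show ?thesis using v by (auto simp: algebra_simps)
    qed
    then show False
    proof (rule front_limit[where Q = "\<lambda>K. K \<notin> C", OF s])
      fix K assume "K \<notin> C" "s + \<sigma> * u \<in> cov K"
      then show False using closed[OF inC hid_covers] by simp
    qed
  qed
  have "u > 0" using out u start by (cases "u = 0") auto
  have near: "\<exists>v. 0 < v \<and> v < \<epsilon> \<and> front (s + \<sigma> * u + (- \<sigma>) * v) \<in> C" if "\<epsilon> > 0" for \<epsilon>
  proof -
    have "u - \<epsilon> < Sup A" "A \<noteq> {}" using u_def that A by auto
    then obtain a where a: "a \<in> A" "u - \<epsilon> < a" using less_cSupD by blast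
    have "a \<le> u" using a A cSup_upper u_def by blast
    moreover have "a \<noteq> u" using a out by (auto simp: A_def)
    ultimately have "0 < u - a" "u - a < \<epsilon>" "front (s + \<sigma> * u + (- \<sigma>) * (u - a)) \<in> C"
      using a by (auto simp: A_def algebra_simps)
    then show ?thesis by blast
  qed
  have s': "- \<sigma> \<in> {1, - 1}" using s by auto
  obtain J where J: "J \<in> C" "s + \<sigma> * u \<in> cov J"
    "\<And>\<epsilon>. \<epsilon> > 0 \<Longrightarrow> \<exists>v. 0 < v \<and> v < \<epsilon> \<and> front (s + \<sigma> * u + (- \<sigma>) * v) = J"
    using front_limit[where Q = "\<lambda>K. K \<in> C", OF s' near] by metis
  have "lean (- \<sigma>) (s + \<sigma> * u)" by (rule leans_at_edge[OF s' _ J(3)]) (use J out in auto)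
  then show thesis by (rule that[OF \<open>u > 0\<close> out J(1) hid_covers[OF J(2)]])
qed

text \<open>
  A view that leans in the direction \<open>\<sigma>\<close> reaches no layer that is present a half turn further on,
  so the front leaves the reached set before.
\<close>

lemma exit_reach:
  assumes s: "\<sigma> \<in> {1, - 1}" and l: "lean \<sigma> s"
  obtains u J where "0 < u" "\<not> reach (front s) (front (s + \<sigma> * u))" "reach (front s) J"
    "hid (front (s + \<sigma> * u)) J" "lean (- \<sigma>) (s + \<sigma> * u)"
proof -
  have out: "front (s + \<sigma> * pi) \<notin> {K. reach (front s) K}"
    using leanD[OF l _ front_cov, of "s + \<sigma> * pi"] s by auto
  have cl: "K \<in> {K. reach (front s) K}" if "J \<in> {K. reach (front s) K}" "hid J K" for J K
    using that by (auto intro: rtranclp.rtrancl_into_rtrancl)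
  have start: "front s \<in> {K. reach (front s) K}" by simp
  show thesis
  proof (rule exit_hidden_set[OF s cl start pi_gt_zero out])
    fix u J
    assume "0 < u" "front (s + \<sigma> * u) \<notin> {K. reach (front s) K}" "J \<in> {K. reach (front s) K}"
      "hid (front (s + \<sigma> * u)) J" "lean (- \<sigma>) (s + \<sigma> * u)"
    then show thesis by (intro that[of u J]) simp_all
  qed
qed

text \<open>The preorder that reachability induces on components, forgetting the lifts.\<close>

definition over :: "'x \<Rightarrow> 'x \<Rightarrow> bool" where
  "over x y \<longleftrightarrow> (\<exists>k l. reach (x, k) (y, l))"

lemma overE:
  assumes "over x y" obtains l where "reach (x, k) (y, l)"
proof -
  obtain k' l where "reach (x, k') (y, l)" using assms unfolding over_def by (elim exE)
  from reach_shift[OF this, of "k - k'"] show thesis using that by simp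
qed

lemma over_refl: "over x x"
  unfolding over_def by (intro exI) (rule rtranclp.rtrancl_refl)

lemma over_trans:
  assumes "over x y" "over y z" shows "over x z"
proof -
  obtain k l where 1: "reach (x, k) (y, l)" using assms(1) unfolding over_def by (elim exE)
  obtain j where "reach (y, l) (z, j)" by (rule overE[OF assms(2)])
  with 1 have "reach (x, k) (z, j)" by (rule rtranclp_trans)
  then show ?thesis unfolding over_def by (intro exI)
qed

lemma reach_over: "reach J K \<Longrightarrow> over (fst J) (fst K)"
  unfolding over_def by (intro exI[of _ "snd J"] exI[of _ "snd K"]) simp

lemma hid_over: "hid J K \<Longrightarrow> over (fst J) (fst K)"
  by (rule reach_over) (rule r_into_rtranclp)

lemma front_over:
  assumes "y \<in> X" obtains s where "over (fst (front s)) y"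
proof -
  obtain s where "s \<in> cov (y, 0)" using cov_nonempty assms by blast
  from hid_over[OF hid_covers[OF this]] show thesis using that by simp
qed

text \<open>
  For a set of components, periodicity supplies an angle with front outside the set in either
  direction.
\<close>

lemma exit_orbits:
  assumes s: "\<sigma> \<in> {1, - 1}"
    and closed: "\<And>x y. x \<in> Y \<Longrightarrow> over x y \<Longrightarrow> y \<in> Y"
    and "fst (front u) \<in> Y" "fst (front t) \<notin> Y"
  obtains s' y where "fst (front s') \<notin> Y" "y \<in> Y" "over (fst (front s')) y" "lean (- \<sigma>) s'"
proof -
  obtain m :: nat where m: "real m > \<bar>t - u\<bar>" using reals_Archimedean2 by blast
  define j where "j = (if \<sigma> = 1 then int m else - int m)"
  define T where "T = \<sigma> * (t + 2 * pi * of_int j - u)"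
  have "real m \<le> 2 * pi * real m" using pi_gt3 by (simp add: mult_le_cancel_right1)
  then have "T > 0" using m s by (auto simp: T_def j_def algebra_simps)
  have "s + \<sigma> * T = t + 2 * pi * of_int j + (s - u)" for s using s by (auto simp: T_def algebra_simps)
  then have "u + \<sigma> * T = t + 2 * pi * of_int j" by simp
  then have out: "front (u + \<sigma> * T) \<notin> {K. fst K \<in> Y}" using front_shift assms by simp
  have cl: "K \<in> {K. fst K \<in> Y}" if "J \<in> {K. fst K \<in> Y}" "hid J K" for J K
    using closed[OF _ hid_over[OF that(2)]] that(1) by simp
  have inY: "front u \<in> {K. fst K \<in> Y}" using assms(3) by simp
  show thesis
  proof (rule exit_hidden_set[OF s cl inY \<open>T > 0\<close> out])
    fix v J
    assume v: "front (u + \<sigma> * v) \<notin> {K. fst K \<in> Y}" "J \<in> {K. fst K \<in> Y}" "hid (front (u + \<sigma> * v)) J"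
      "lean (- \<sigma>) (u + \<sigma> * v)"
    show thesis by (rule that[of "u + \<sigma> * v" "fst J"]) (use v hid_over[OF v(3)] in simp_all)
  qed
qed

text \<open>
  Let \<open>D\<close> be the set of components that do not reach \<open>A\<close>. The rest contains fronts leaning either
  way: if a component of \<open>D\<close> is seen, one meets them on leaving \<open>D\<close> upwards and downwards;
  otherwise because every lean produces an opposite one. Leaving the layers reached by a left
  leaning front of this kind, one finds a layer \<open>(x, k)\<close> outside that hides a layer \<open>J\<close> inside. But
  another copy of \<open>x\<close> is reached, and with it another copy of \<open>J\<close>, against \<open>opposite_leans\<close>.
\<close>

lemma no_dominating_orbit:
  assumes A: "A \<in> X" and dom: "\<And>y. y \<in> X \<Longrightarrow> over A y"
  shows False
proof -
  define D where "D = {y. \<not> over y A}"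
  have closed: "y \<in> D" if "x \<in> D" "over x y" for x y using that over_trans D_def by blast
  obtain t where "over (fst (front t)) A" by (rule front_over[OF A])
  then have t: "fst (front t) \<notin> D" by (simp add: D_def)
  have both: "\<exists>s. lean \<sigma> s \<and> fst (front s) \<notin> D" if s: "\<sigma> \<in> {1, - 1}" for \<sigma>
  proof (cases "\<exists>u. fst (front u) \<in> D")
    case True
    then obtain u where u: "fst (front u) \<in> D" by blast
    have ns: "- \<sigma> \<in> {1, - 1}" using s by auto
    obtain s' y where "fst (front s') \<notin> D" "y \<in> D" "over (fst (front s')) y" "lean (- (- \<sigma>)) s'"
      by (rule exit_orbits[OF ns closed u t])
    then show ?thesis by auto
  next
    case False
    obtain \<rho> where \<rho>: "\<rho> \<in> {1, - 1}" "lean \<rho> t" using leans_cases by blast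
    obtain s where "lean (- \<rho>) s" by (rule exit_reach[OF \<rho>])
    then show ?thesis using False \<rho> s by (cases "\<sigma> = \<rho>") auto
  qed
  obtain s1 where s1: "lean 1 s1" "over (fst (front s1)) A" using both[of 1] D_def by auto
  obtain s2 where s2: "lean (- 1) s2" "over (fst (front s2)) A" using both[of "- 1"] D_def by auto
  have top: "over (fst (front s1)) y" "over (fst (front s2)) y" if "y \<in> X" for y
    using that dom s1 s2 over_trans by blast+
  obtain l where l: "reach (front s1) (fst (front s2), l)"
    using overE[OF top(1)[OF fst_front[of s2]], of "snd (front s1)"] by auto
  define m where "m = l - snd (front s2)"
  define s2' where "s2' = s2 + 2 * pi * of_int m"
  have F2: "front s2' = (fst (front s2), l)" unfolding s2'_def front_shift by (simp add: m_def)
  have l2: "lean (- 1) s2'" using lean_shift s2 s2'_def by blast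
  have one: "(1::real) \<in> {1, - 1}" by simp
  obtain u J where u: "\<not> reach (front s1) (front (s1 + 1 * u))" "reach (front s1) J" "hid (front (s1 + 1 * u)) J"
    by (rule exit_reach[OF one s1(1)])
  obtain x k where K: "front (s1 + 1 * u) = (x, k)" by force
  obtain y j where J: "J = (y, j)" by force
  have "x \<in> X" using fst_front[of "s1 + 1 * u"] K by simp
  then obtain k' where k': "reach (front s1) (x, k')"
    using overE[OF top(1), of x "snd (front s1)"] by auto
  have "k \<noteq> k'" using k' u K by auto
  have "reach (x, k') (y, j + (k' - k))"
    using reach_shift[of x k y j "k' - k"] u(3) K J by auto
  then have r1: "reach (front s1) (y, j)" "reach (front s1) (y, j + (k' - k))" using u J k' by auto
  obtain i where i: "reach (front s2') (fst (front s1), i)"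
    using overE[OF top(2)[OF fst_front[of s1]], of l] F2 by auto
  have sh: "reach (front s2') (y, q + (i - snd (front s1)))" if "reach (front s1) (y, q)" for q
    using reach_shift[of "fst (front s1)" "snd (front s1)" y q "i - snd (front s1)"] that i by auto
  show False
    by (rule opposite_leans[OF _ s1(1) l2 one sh[OF r1(1)] sh[OF r1(2)]]) (use l F2 \<open>k \<noteq> k'\<close> in simp_all)
qed

text \<open>
  A layer of a component that is hidden by no other component is in front wherever it is present; so
  at its last angle another layer takes over.
\<close>

lemma last_sight:
  assumes y: "y \<in> X" and top: "\<And>x. x \<in> X \<Longrightarrow> over x y \<Longrightarrow> x = y"
  obtains s where "front s = (y, 0)" "\<And>t. front t = (y, 0) \<Longrightarrow> t \<le> s" "lean 1 s"
proof -
  have front: "front t = (y, 0)" if "t \<in> cov (y, 0)" for t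
  proof -
    have "fst (front t) = y" using top[OF fst_front] hid_over[OF hid_covers[OF that]] by simp
    moreover have "snd (front t) = 0"
      using no_self_hiding[of y "snd (front t)" 0] hid_covers[OF that] calculation by (metis prod.collapse)
    ultimately show ?thesis by (metis prod.collapse)
  qed
  have ne: "cov (y, 0) \<noteq> {}" using cov_nonempty y by simp
  obtain s where s: "s \<in> cov (y, 0)" "\<And>t. t \<in> cov (y, 0) \<Longrightarrow> t \<le> s"
    using compact_attains_sup[OF cov_compact ne] by blast
  have le: "t \<le> s" if "front t = (y, 0)" for t using front_cov[of t] that s by simp
  have "\<exists>u. 0 < u \<and> u < \<epsilon> \<and> front (s + 1 * u) \<noteq> (y, 0)" if "\<epsilon> > 0" for \<epsilon>
    using le[of "s + \<epsilon> / 2"] that by (intro exI[of _ "\<epsilon> / 2"]) auto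
  then obtain K where K: "K \<noteq> (y, 0)" "\<And>\<epsilon>. \<epsilon> > 0 \<Longrightarrow> \<exists>u. 0 < u \<and> u < \<epsilon> \<and> front (s + 1 * u) = K"
    using front_limit[where Q = "\<lambda>K. K \<noteq> (y, 0)" and s = s and \<sigma> = 1] by (metis insertI1)
  have "lean 1 s" by (rule leans_at_edge[OF _ _ K(2)]) (use K front s in auto)
  then show thesis using that front s le by blast
qed

text \<open>
  From the last angle where \<open>A\<close> is seen, the exit from the layers hidden by \<open>A\<close> must lead to \<open>B\<close>:
  another copy of \<open>A\<close> is excluded by \<open>opposite_leans\<close>, and \<open>c\<close> hides nothing but itself. From the last
  angle where \<open>B\<close> is seen one gets back to \<open>A\<close> in the same way. Since \<open>A\<close> and \<open>B\<close> are
  seen with both leans, each of their copies hides only one copy of \<open>c\<close>; hence the copy of \<open>A\<close> found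
  in the end is the one left at the beginning.
\<close>

lemma no_two_tops_one_bottom:
  assumes X: "X = {A, B, c}" and dist: "A \<noteq> B" "A \<noteq> c" "B \<noteq> c"
    and nAB: "\<not> over A B" "\<not> over B A" "\<not> over c A" "\<not> over c B"
  shows False
proof -
  have one: "(1::real) \<in> {1, - 1}" by simp
  have bottom: "K = J" if "reach J K" "fst J = c" for J K
    using that
  proof (induction rule: rtranclp_induct)
    case (step K L)
    have "fst L \<in> X" using step.hyps(2) cov_fst unfolding hides_def by blast
    moreover have "over c (fst L)" using step hid_over by metis
    ultimately have "fst L = c" using X nAB by auto
    then show ?case using no_self_hiding step by (metis prod.collapse)
  qed auto
  have next_top: "\<exists>t k l. s < t \<and> front t = (y', k) \<and> lean (- 1) t \<and> reach (y', k) (c, l) \<and> reach (y, 0) (c, l)"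
    if yy: "{y, y'} = {A, B}" and s: "front s = (y, 0)" "lean 1 s" for y y' s
  proof -
    obtain u J where u: "0 < u" "\<not> reach (front s) (front (s + 1 * u))" "reach (front s) J" "hid (front (s + 1 * u)) J"
        "lean (- 1) (s + 1 * u)" by (rule exit_reach[OF one s(2)])
    obtain x k where K: "front (s + 1 * u) = (x, k)" by force
    obtain z j where J: "J = (z, j)" by force
    have x: "x \<in> X" using fst_front[of "s + 1 * u"] K by simp
    have z: "z \<in> X" using reach_fst[OF u(3) fst_front] J by simp
    have "x \<noteq> c" using bottom[of "front (s + 1 * u)" J] u K by (auto)
    moreover have "x \<noteq> y"
    proof
      assume xy: "x = y"
      have "k \<noteq> 0" using xy u(2) K s by auto
      define s2 where "s2 = (s + 1 * u) + 2 * pi * of_int (- k)"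
      have F2: "front s2 = (y, 0)" using front_shift[of "s + 1 * u" "- k"] K xy s2_def by simp
      have l2: "lean (- 1) s2" using lean_shift[OF u(5), of "- k"] s2_def by simp
      have "reach (y, 0) (z, j + (- k))" using reach_shift[of y k z j "- k"] u(4) K J xy by auto
      then show False using opposite_leans[of s s2 1 z j "j + (- k)"] F2 l2 s u(3) J \<open>k \<noteq> 0\<close> by auto
    qed
    ultimately have xy': "x = y'" using x X yy by auto
    have "over y z" "over y' z" using reach_over[OF u(3)] hid_over[OF u(4)] s K J xy' by auto
    then have "z = c" using z X yy nAB by (auto simp: doubleton_eq_iff)
    then show ?thesis using u K J s xy' by (intro exI[of _ "s + u"] exI[of _ k] exI[of _ j]) auto
  qed
  have topA: "x = A" if "x \<in> X" "over x A" for x using that X nAB by auto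
  have topB: "x = B" if "x \<in> X" "over x B" for x using that X nAB by auto
  obtain a where a: "front a = (A, 0)" "\<And>t. front t = (A, 0) \<Longrightarrow> t \<le> a" "lean 1 a"
    using last_sight[of A] X topA by auto
  obtain b where b: "front b = (B, 0)" "\<And>t. front t = (B, 0) \<Longrightarrow> t \<le> b" "lean 1 b"
    using last_sight[of B] X topB by auto
  obtain t k l where t: "a < t" "front t = (B, k)" "lean (- 1) t" "reach (B, k) (c, l)" "reach (A, 0) (c, l)"
    using next_top[of A B a] a by blast
  obtain t' k' l' where t': "b < t'" "front t' = (A, k')" "lean (- 1) t'" "reach (A, k') (c, l')" "reach (B, 0) (c, l')"
    using next_top[of B A b] b by blast
  define t2 where "t2 = t + 2 * pi * of_int (- k)"
  have t2: "front t2 = (B, 0)" "lean (- 1) t2" "reach (B, 0) (c, l + (- k))"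
    using front_shift[of t "- k"] lean_shift[OF t(3), of "- k"] reach_shift[OF t(4), of "- k"] t t2_def by auto
  have l: "l' = l - k" using opposite_leans[of b t2 1 c l' "l - k"] b t2 t' by auto
  define t3 where "t3 = t' + 2 * pi * of_int (- k')"
  have t3: "front t3 = (A, 0)" "lean (- 1) t3" "reach (A, 0) (c, l' + (- k'))"
    using front_shift[of t' "- k'"] lean_shift[OF t'(3), of "- k'"] reach_shift[OF t'(4), of "- k'"] t' t3_def by auto
  have "l = l' - k'" using opposite_leans[of a t3 1 c l "l' - k'"] a t3 t by auto
  then have "k' = - k" using l by simp
  then have "t3 = t' + 2 * pi * of_int k" by (simp add: t3_def)
  moreover have "t2 \<le> b" using b t2 by blast
  ultimately have "t3 > a" using t t' by (simp add: t2_def)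
  then show False using a t3 by force
qed

text \<open>
  Take \<open>A\<close> with the largest number of components below it. It does not dominate everything, so some
  \<open>B\<close> outside hides a component below \<open>A\<close>; by maximality \<open>B\<close> is not above \<open>A\<close>. With three
  components this is exactly the configuration with two tops and one bottom.
\<close>

theorem four_le_card: "4 \<le> card X"
proof (rule ccontr)
  assume "\<not> ?thesis"
  then have card: "card X \<le> 3" by simp
  define r where "r x = {y \<in> X. over x y}" for x
  have finr: "finite (r x)" for x using finite_X r_def by simp
  have "X \<noteq> {}" using fst_front by blast
  obtain A where A: "A \<in> X" and maxA: "\<And>x. x \<in> X \<Longrightarrow> card (r x) \<le> card (r A)"
  proof -
    have "Max ((\<lambda>x. card (r x)) ` X) \<in> (\<lambda>x. card (r x)) ` X" using finite_X \<open>X \<noteq> {}\<close> by (intro Max_in) auto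
    then obtain A where "A \<in> X" "Max ((\<lambda>x. card (r x)) ` X) = card (r A)" by blast
    moreover have "card (r x) \<le> Max ((\<lambda>x. card (r x)) ` X)" if "x \<in> X" for x
      using finite_X that by (intro Max_ge) auto
    ultimately show thesis by (intro that[of A]) auto
  qed
  have "\<exists>y\<in>X. \<not> over A y" using no_dominating_orbit[OF A] by (rule ccontr) simp
  then obtain y where y: "y \<in> X" "\<not> over A y" by blast
  define Y where "Y = {y. over A y}"
  have closed: "w \<in> Y" if "z \<in> Y" "over z w" for z w
    using that over_trans[of A z w] by (simp add: Y_def)
  obtain t where t: "over (fst (front t)) y" by (rule front_over[OF y(1)])
  have tY: "fst (front t) \<notin> Y" using over_trans[OF _ t] y by (auto simp: Y_def)
  obtain u where u: "over (fst (front u)) A" by (rule front_over[OF A])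
  have "\<exists>B c. B \<in> X \<and> B \<notin> Y \<and> c \<in> Y \<and> over B c"
  proof (cases "fst (front u) \<in> Y")
    case False
    moreover have "A \<in> Y" using over_refl by (simp add: Y_def)
    ultimately show ?thesis using u fst_front by blast
  next
    case True
    obtain s' z where "fst (front s') \<notin> Y" "z \<in> Y" "over (fst (front s')) z"
      by (rule exit_orbits[OF _ closed True tY, where \<sigma> = 1]) auto
    then show ?thesis using fst_front by blast
  qed
  then obtain B c where B: "B \<in> X" "\<not> over A B" and c: "over A c" "over B c" using Y_def by blast
  have cX: "c \<in> X" using overE[OF c(2)] reach_fst B(1) by (metis fst_conv)
  have nBA: "\<not> over B A"
  proof
    assume "over B A"
    then have "r A \<subseteq> r B" "B \<in> r B" "B \<notin> r A" using over_trans over_refl B by (auto simp: r_def)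
    then have "r A \<subset> r B" by blast
    from psubset_card_mono[OF finr this] maxA[OF B(1)] show False by simp
  qed
  have d: "A \<noteq> B" "A \<noteq> c" "B \<noteq> c" using B(2) c nBA over_refl by auto
  then have "card {A, B, c} = 3" by simp
  then have "{A, B, c} = X"
    using card_seteq[OF finite_X, of "{A, B, c}"] A B(1) cX card by simp
  moreover have "\<not> over c A" using over_trans[OF c(2)] nBA by blast
  moreover have "\<not> over c B" using over_trans[OF c(1)] B(2) by blast
  ultimately show False by (intro no_two_tops_one_bottom[OF _ d B(2) nBA]) simp_all
qed

end

section \<open>The argument on the complement of a bent half-line\<close>

text \<open>
  The model cut runs from \<open>0\<close> along the real axis to \<open>r\<close> and then in the direction \<open>cis \<tau>\<close>. The
  function \<open>side r \<tau>\<close> is negative to the right of the line through \<open>r\<close> with that direction.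
\<close>

definition side :: "real \<Rightarrow> real \<Rightarrow> complex \<Rightarrow> real" where
  "side r \<tau> w = Im w * cos \<tau> - (Re w - r) * sin \<tau>"

definition on_cut :: "real \<Rightarrow> real \<Rightarrow> complex \<Rightarrow> bool" where
  "on_cut r \<tau> w \<longleftrightarrow> (0 \<le> Im w \<and> side r \<tau> w = 0) \<or> (Im w = 0 \<and> 0 \<le> Re w \<and> Re w \<le> r)"

text \<open>
  The branch of the argument with values in \<open>{- 2 * pi<..<\<tau>}\<close> off the cut: near the
  segment it is close to \<open>0\<close> on the right and close to \<open>- 2 * pi\<close> on the left.
\<close>

definition bent_arg :: "real \<Rightarrow> real \<Rightarrow> complex \<Rightarrow> real" where
  "bent_arg r \<tau> w = (if Im w < 0 \<or> side r \<tau> w < 0 then Arg w else Arg w - 2 * pi)"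

lemma side_rcis: "side r \<tau> (rcis \<rho> a) = \<rho> * sin (a - \<tau>) + r * sin \<tau>"
  by (simp add: side_def sin_diff algebra_simps)

lemma continuous_side: "continuous_on S (side r \<tau>)"
  unfolding side_def by (intro continuous_intros)

lemma side_neg_real:
  assumes "0 < \<tau>" "\<tau> < pi" "0 < r" "Im w = 0" "side r \<tau> w < 0"
  shows "Re w > r"
proof -
  have "0 < (Re w - r) * sin \<tau>" using assms by (simp add: side_def)
  then show ?thesis using sin_gt_zero[OF assms(1,2)] by (simp add: zero_less_mult_iff)
qed

lemma cis_bent_arg:
  assumes "w \<noteq> 0" shows "cis (bent_arg r \<tau> w) = sgn w"
proof -
  have "cis (Arg w - 2 * pi) = cis (Arg w)" by (simp flip: cis_divide)
  then show ?thesis using cis_Arg[OF assms] by (simp add: bent_arg_def)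
qed

lemma bent_arg_bounds:
  assumes \<tau>: "0 < \<tau>" "\<tau> < pi" "0 < r" and w: "\<not> on_cut r \<tau> w"
  shows "- 2 * pi < bent_arg r \<tau> w" "bent_arg r \<tau> w < \<tau>"
proof -
  note A = Arg_bounded[of w]
  have st: "sin \<tau> > 0" using \<tau> sin_gt_zero by simp
  show "- 2 * pi < bent_arg r \<tau> w"
  proof (cases "Im w < 0 \<or> side r \<tau> w < 0")
    case True
    then show ?thesis using A pi_gt_zero by (auto simp: bent_arg_def)
  next
    case False
    then have "Arg w \<ge> 0" using Arg_neg_iff[of w] by linarith
    moreover have "Arg w \<noteq> 0"
    proof
      assume "Arg w = 0"
      then have re: "Im w = 0" "0 \<le> Re w" using Arg_eq_0[of w] complex_is_Real_iff by auto
      then have "(Re w - r) * sin \<tau> \<le> 0" using False by (simp add: side_def)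
      then have "Re w \<le> r" using st by (simp add: mult_le_0_iff)
      then show False using re w by (simp add: on_cut_def)
    qed
    ultimately show ?thesis using False by (auto simp: bent_arg_def)
  qed
  show "bent_arg r \<tau> w < \<tau>"
  proof (cases "Im w < 0 \<or> side r \<tau> w < 0")
    case True
    have "Arg w < \<tau>"
    proof (rule ccontr)
      assume n: "\<not> ?thesis"
      then have "Im w \<ge> 0" using Arg_neg_iff[of w] \<tau> by linarith
      then have "side r \<tau> w < 0" using True by simp
      moreover have "side r \<tau> w = cmod w * sin (Arg w - \<tau>) + r * sin \<tau>"
        using side_rcis[of r \<tau> "cmod w" "Arg w"] by (simp add: rcis_cmod_Arg)
      moreover have "sin (Arg w - \<tau>) \<ge> 0" using n A \<tau> by (intro sin_ge_zero) auto
      moreover have "r * sin \<tau> > 0" using st \<tau> by simp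
      ultimately show False by (smt (verit) mult_nonneg_nonneg norm_ge_zero)
    qed
    then show ?thesis using True by (auto simp: bent_arg_def)
  next
    case False
    then show ?thesis using A \<tau> by (auto simp: bent_arg_def)
  qed
qed

text \<open>
  Off the cut either the principal argument is used on a neighbourhood that avoids its branch line,
  or the value is \<open>Arg (- w) - pi\<close> on a neighbourhood that avoids the nonnegative reals.
\<close>

lemma isCont_bent_arg:
  assumes \<tau>: "0 < \<tau>" "\<tau> < pi" "0 < r" and w: "\<not> on_cut r \<tau> w"
  shows "isCont (bent_arg r \<tau>) w"
proof (cases "Im w < 0 \<or> side r \<tau> w < 0")
  case True
  let ?O = "{w. Im w < 0} \<union> {w. side r \<tau> w < 0}"
  have "open ?O"
    by (intro open_Un open_Collect_less continuous_intros continuous_side)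
  then have "\<forall>\<^sub>F z in nhds w. z \<in> ?O" using True by (intro eventually_nhds_in_open) auto
  then have "\<forall>\<^sub>F z in nhds w. bent_arg r \<tau> z = Arg z"
    by (rule eventually_mono) (auto simp: bent_arg_def)
  moreover have "w \<notin> \<real>\<^sub>\<le>\<^sub>0"
    using True side_neg_real[OF \<tau>, of w] \<tau> by (auto simp: complex_nonpos_Reals_iff)
  ultimately show ?thesis using continuous_at_Arg by (simp add: isCont_cong)
next
  case False
  let ?O = "{w. 0 < side r \<tau> w} \<inter> - \<real>\<^sub>\<ge>\<^sub>0"
  have st: "sin \<tau> > 0" using \<tau> sin_gt_zero by simp
  have op: "open ?O"
    by (intro open_Int open_Collect_less continuous_intros continuous_side open_Compl closed_nonneg_Reals_complex)
  have "side r \<tau> w \<noteq> 0" using False w by (auto simp: on_cut_def)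
  then have sd: "0 < side r \<tau> w" using False by simp
  have nn: "w \<notin> \<real>\<^sub>\<ge>\<^sub>0"
  proof
    assume "w \<in> \<real>\<^sub>\<ge>\<^sub>0"
    then have re: "Im w = 0" "0 \<le> Re w" by (auto simp: complex_nonneg_Reals_iff)
    then have "(Re w - r) * sin \<tau> < 0" using sd by (simp add: side_def)
    then have "Re w \<le> r" using st by (simp add: mult_less_0_iff)
    then show False using re w by (simp add: on_cut_def)
  qed
  have "\<forall>\<^sub>F z in nhds w. z \<in> ?O" using sd nn op by (intro eventually_nhds_in_open) auto
  then have "\<forall>\<^sub>F z in nhds w. bent_arg r \<tau> z = Arg (- z) - pi"
  proof (rule eventually_mono)
    fix z assume z: "z \<in> ?O"
    then have "z \<noteq> 0" by auto
    note m = Arg_minus[OF this]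
    have "Arg z \<noteq> 0" using z Arg_eq_0[of z] by (auto simp: complex_nonneg_Reals_iff complex_is_Real_iff)
    then show "bent_arg r \<tau> z = Arg (- z) - pi"
      using z m Arg_neg_iff[of z] by (auto simp: bent_arg_def)
  qed
  moreover have "isCont (\<lambda>z. Arg (- z) - pi) w"
  proof -
    have "- w \<notin> \<real>\<^sub>\<le>\<^sub>0" using nn by (auto simp: complex_nonneg_Reals_iff complex_nonpos_Reals_iff)
    from isCont_o2[where f = uminus and g = Arg, OF _ continuous_at_Arg[OF this]]
    have "isCont (\<lambda>z. Arg (- z)) w" by simp
    then show ?thesis by (rule continuous_diff) simp
  qed
  ultimately show ?thesis by (simp add: isCont_cong)
qed

lemma bent_arg_beyond:
  assumes "0 \<le> \<delta>" "\<delta> < pi" "0 < \<rho>" "side r \<tau> (rcis \<rho> \<delta>) < 0"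
  shows "bent_arg r \<tau> (rcis \<rho> \<delta>) = \<delta>"
  using assms by (auto simp: bent_arg_def Arg_rcis)

lemma bent_arg_pos: "bent_arg r \<tau> w > 0 \<Longrightarrow> side r \<tau> w < 0"
  using Arg_bounded[of w] Arg_neg_iff[of w] by (auto simp: bent_arg_def split: if_splits)

text \<open>
  The conditions on \<open>n\<close> say that it has nonnegative inner product with \<open>- 1\<close> and with \<open>cis \<tau>\<close>, the
  directions of the cut at its corner. So \<open>- n\<close> is not in the convex cone that they
  span, and this cone is all that lies to the left of the cut near the corner.
\<close>

lemma bent_arg_corner:
  assumes \<tau>: "0 < \<tau>" "\<tau> < pi" "0 < r"
    and n: "n \<noteq> 0" "Re n \<le> 0" "Re n * cos \<tau> + Im n * sin \<tau> \<ge> 0"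
  shows "((\<lambda>t. bent_arg r \<tau> (of_real r - of_real t * n)) \<longlongrightarrow> 0) (at_right 0)"
proof -
  have st: "sin \<tau> > 0" using \<tau> sin_gt_zero by simp
  have *: "- Im n < 0 \<or> Re n * sin \<tau> - Im n * cos \<tau> < 0"
  proof (cases "Im n > 0")
    case False
    show ?thesis
    proof (cases "Im n = 0")
      case True
      then have "Re n < 0" using n by (simp add: complex_eq_iff)
      then show ?thesis using True st by (simp add: mult_neg_pos)
    next
      case F: False
      then have "Im n < 0" using False by simp
      then have "Im n * sin \<tau> < 0" using st by (simp add: mult_neg_pos)
      then have "Re n * cos \<tau> > 0" using n by simp
      then have "Re n < 0" "cos \<tau> < 0" using n(2) by (auto simp: zero_less_mult_iff)
      then have "Re n * sin \<tau> < 0" "Im n * cos \<tau> > 0"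
        using st \<open>Im n < 0\<close> by (simp_all add: mult_neg_pos mult_neg_neg)
      then show ?thesis by simp
    qed
  qed auto
  have "bent_arg r \<tau> (of_real r - of_real t * n) = Arg (of_real r - of_real t * n)" if "t > 0" for t
  proof -
    have "side r \<tau> (of_real r - of_real t * n) = t * (Re n * sin \<tau> - Im n * cos \<tau>)"
      by (simp add: side_def algebra_simps)
    then show ?thesis using * that by (auto simp: bent_arg_def mult_pos_neg)
  qed
  then have "\<forall>\<^sub>F t in at_right 0. bent_arg r \<tau> (of_real r - of_real t * n) = Arg (of_real r - of_real t * n)"
    by (auto simp: eventually_at_filter)
  moreover have "((\<lambda>t. Arg (of_real r - of_real t * n)) \<longlongrightarrow> 0) (at_right 0)"
  proof -
    have "complex_of_real r \<notin> \<real>\<^sub>\<le>\<^sub>0" using \<tau> by (simp add: complex_nonpos_Reals_iff)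
    then have "isCont Arg (of_real r)" by (rule continuous_at_Arg)
    moreover have "((\<lambda>t. of_real r - of_real t * n) \<longlongrightarrow> of_real r - of_real 0 * n) (at_right 0)"
      by (intro tendsto_intros)
    ultimately have "((\<lambda>t. Arg (of_real r - of_real t * n)) \<longlongrightarrow> Arg (of_real r)) (at_right 0)"
      by (intro isCont_tendsto_compose[where g = Arg]) auto
    then show ?thesis using \<tau> by (simp add: Arg_eq_0)
  qed
  ultimately show ?thesis by (simp add: filterlim_cong)
qed

text \<open>
  Rotates the direction \<open>\<theta>\<close> to the positive reals and reflects if \<open>\<sigma> = - 1\<close>, so that a cut that
  turns right becomes the model cut, which turns left.
\<close>

definition tilt :: "real \<Rightarrow> real \<Rightarrow> complex \<Rightarrow> complex" where
  "tilt \<sigma> \<theta> z = Complex (Re (z * cis (- \<theta>))) (\<sigma> * Im (z * cis (- \<theta>)))"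

lemma tilt_rcis: "\<sigma> \<in> {1, - 1} \<Longrightarrow> tilt \<sigma> \<theta> (rcis \<rho> a) = rcis \<rho> (\<sigma> * (a - \<theta>))"
proof -
  have "rcis \<rho> a * cis (- \<theta>) = rcis \<rho> (a - \<theta>)" by (simp add: rcis_def cis_mult mult.assoc)
  moreover assume "\<sigma> \<in> {1, - 1}"
  moreover have "cos (\<theta> - a) = cos (a - \<theta>)" "sin (\<theta> - a) = - sin (a - \<theta>)"
    by (metis cos_minus minus_diff_eq, metis sin_minus minus_diff_eq)
  ultimately show ?thesis by (auto simp: tilt_def complex_eq_iff)
qed

lemma tilt_cis: "\<sigma> \<in> {1, - 1} \<Longrightarrow> tilt \<sigma> \<theta> (cis a) = cis (\<sigma> * (a - \<theta>))"
  using tilt_rcis[of \<sigma> \<theta> 1 a] by (simp add: rcis_def)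

lemma untilt: "\<sigma> \<in> {1, - 1} \<Longrightarrow> z = cis \<theta> * Complex (Re (tilt \<sigma> \<theta> z)) (\<sigma> * Im (tilt \<sigma> \<theta> z))"
proof -
  assume "\<sigma> \<in> {1, - 1}"
  then have "Complex (Re (tilt \<sigma> \<theta> z)) (\<sigma> * Im (tilt \<sigma> \<theta> z)) = z * cis (- \<theta>)"
    by (auto simp: tilt_def complex_eq_iff)
  moreover have "cis \<theta> * (z * cis (- \<theta>)) = z" by (simp add: mult.left_commute cis_mult)
  ultimately show ?thesis by simp
qed

lemma tilt_add: "tilt \<sigma> \<theta> (a + b) = tilt \<sigma> \<theta> a + tilt \<sigma> \<theta> b"
  by (simp add: tilt_def complex_eq_iff algebra_simps)

lemma tilt_scale: "tilt \<sigma> \<theta> (of_real t * b) = of_real t * tilt \<sigma> \<theta> b"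
  by (simp add: tilt_def complex_eq_iff algebra_simps)

lemma tilt_inner: "\<sigma> \<in> {1, - 1} \<Longrightarrow> tilt \<sigma> \<theta> a \<bullet> tilt \<sigma> \<theta> b = a \<bullet> b"
proof -
  assume s: "\<sigma> \<in> {1, - 1}"
  have "tilt \<sigma> \<theta> a \<bullet> tilt \<sigma> \<theta> b = (a * cis (- \<theta>)) \<bullet> (b * cis (- \<theta>))"
    using s by (auto simp: tilt_def inner_complex_def)
  also have "\<dots> = a \<bullet> b"
  proof -
    have "(x * c + y * s) * (x' * c + y' * s) + (y * c - x * s) * (y' * c - x' * s)
        = (x * x' + y * y') * (c\<^sup>2 + s\<^sup>2)" for x y x' y' c s :: real
      by algebra
    from this[of "Re a" "cos \<theta>" "Im a" "sin \<theta>" "Re b" "Im b"] show ?thesis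
      by (simp add: inner_complex_def)
  qed
  finally show ?thesis by simp
qed

lemma tilt_nonzero: "\<sigma> \<in> {1, - 1} \<Longrightarrow> z \<noteq> 0 \<Longrightarrow> tilt \<sigma> \<theta> z \<noteq> 0"
  using tilt_inner[of \<sigma> \<theta> z z] by fastforce

lemma continuous_tilt: "continuous_on S (tilt \<sigma> \<theta>)"
  unfolding tilt_def Complex_eq by (intro continuous_intros)

text \<open>The difference of two branches of the argument is continuous with discrete range.\<close>

lemma continuous_args_differ_by_period:
  fixes f g :: "complex \<Rightarrow> real"
  assumes D: "connected D" "D \<noteq> {}" and f: "continuous_on D f" and g: "continuous_on D g"
    and eq: "\<And>z. z \<in> D \<Longrightarrow> cis (f z) = cis (g z)"
  shows "\<exists>m :: int. \<forall>z\<in>D. f z = g z + 2 * pi * of_int m"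
proof -
  have int: "\<exists>m::int. f z - g z = 2 * pi * of_int m" if "z \<in> D" for z
  proof -
    have "cis (f z - g z) = 1" using eq[OF that] by (metis cis_divide cis_neq_zero divide_self)
    then have "exp (\<i> * of_real (f z - g z)) = 1" by (simp add: cis_conv_exp)
    then obtain m :: int where "Im (\<i> * of_real (f z - g z)) = of_int (2 * m) * pi"
      using exp_eq_1 by blast
    then show ?thesis by (intro exI[of _ m]) (simp add: algebra_simps)
  qed
  have "(\<lambda>z. f z - g z) constant_on D"
  proof (rule continuous_discrete_range_constant[OF D(1)])
    show "continuous_on D (\<lambda>z. f z - g z)" by (intro continuous_intros f g)
    fix x assume x: "x \<in> D"
    show "\<exists>e>0. \<forall>y. y \<in> D \<and> f y - g y \<noteq> f x - g x \<longrightarrow> e \<le> norm (f y - g y - (f x - g x))"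
    proof (intro exI[of _ "2 * pi"] conjI allI impI)
      fix y assume y: "y \<in> D \<and> f y - g y \<noteq> f x - g x"
      obtain a :: int where a: "f x - g x = 2 * pi * of_int a" using int[OF x] by blast
      obtain b :: int where b: "f y - g y = 2 * pi * of_int b" using int y by blast
      have "a \<noteq> b" using y a b by auto
      then have "\<bar>real_of_int (b - a)\<bar> \<ge> 1" by linarith
      moreover have "f y - g y - (f x - g x) = 2 * pi * real_of_int (b - a)" using a b by (simp add: algebra_simps)
      ultimately show "2 * pi \<le> norm (f y - g y - (f x - g x))" by (simp add: abs_mult)
    qed simp
  qed
  then obtain c where c: "\<And>z. z \<in> D \<Longrightarrow> f z - g z = c" unfolding constant_on_def by blast
  obtain z where z: "z \<in> D" using D by blast
  obtain m :: int where m: "f z - g z = 2 * pi * of_int m" using int z by blast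
  have "f x = g x + 2 * pi * of_int m" if "x \<in> D" for x using c[OF that] c[OF z] m by linarith
  then show ?thesis by blast
qed

section \<open>Free rays at the first boundary points seen from a dark point\<close>

lemma rcis_eq_period:
  assumes "0 < \<rho>" "rcis \<rho> a = rcis \<rho> b" obtains m :: int where "a = b + 2 * pi * of_int m"
proof -
  have "cis a = cis b" using assms by (auto simp: rcis_def)
  then have "\<exists>m :: int. \<forall>z\<in>{0 :: complex}. a = b + 2 * pi * of_int m"
    by (intro continuous_args_differ_by_period) simp_all
  then show thesis using that by auto
qed

text \<open>
  The origin sees the bounded open set \<open>E\<close> in every direction. The set is a disjoint union of finitely many
  open connected pieces. Smoothness of the frontier enters as two properties of a frontier point:
  \<open>E\<close> contains the initial part of every ray that enters the open half-plane given by a normal \<open>n\<close>,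
  and all points of \<open>E\<close> close to it lie in one small connected subset of \<open>E\<close>.
\<close>

locale dark_origin =
  fixes E :: "complex set" and X :: "complex set set"
  assumes union: "E = \<Union>X" and finite_X: "finite X"
    and open_piece: "D \<in> X \<Longrightarrow> open D" and connected_piece: "D \<in> X \<Longrightarrow> connected D"
    and nonempty_piece: "D \<in> X \<Longrightarrow> D \<noteq> {}"
    and disjoint_pieces: "\<lbrakk>D \<in> X; D' \<in> X; D \<noteq> D'\<rbrakk> \<Longrightarrow> D \<inter> D' = {}"
    and bounded_E: "bounded E" and origin: "0 \<notin> closure E"
    and dark: "\<exists>t\<ge>0. rcis t \<theta> \<in> E"
    and free_ray: "p \<in> frontier E \<Longrightarrow> \<exists>a. \<forall>t\<ge>0. p + rcis t a \<notin> E"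
    and normal: "p \<in> frontier E \<Longrightarrow> \<exists>n. n \<noteq> 0 \<and>
      (\<forall>v. n \<bullet> v < 0 \<longrightarrow> (\<exists>\<epsilon>>0. \<forall>t. 0 < t \<and> t < \<epsilon> \<longrightarrow> p + of_real t * v \<in> E))"
    and one_sided: "\<lbrakk>p \<in> frontier E; \<epsilon> > 0\<rbrakk> \<Longrightarrow>
      \<exists>\<delta>>0. \<exists>Q. connected Q \<and> E \<inter> ball p \<delta> \<subseteq> Q \<and> Q \<subseteq> E \<inter> ball p \<epsilon>"
begin

lemma open_E: "open E" using open_piece union by auto

lemma piece_subset: "D \<in> X \<Longrightarrow> D \<subseteq> E" using union by blast

lemma frontier_not_in: "p \<in> frontier E \<Longrightarrow> p \<notin> E"
  using open_E by (simp add: frontier_def interior_open)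

lemma connected_in_piece:
  assumes Q: "connected Q" "Q \<subseteq> E" and D: "D \<in> X" "w \<in> D" "w \<in> Q"
  shows "Q \<subseteq> D"
proof (rule ccontr)
  assume n: "\<not> Q \<subseteq> D"
  let ?Rest = "\<Union>(X - {D})"
  have 1: "open D" "open ?Rest" using open_piece D by auto
  have 2: "Q \<subseteq> D \<union> ?Rest" using Q union by auto
  have 3: "D \<inter> ?Rest \<inter> Q = {}" using disjoint_pieces[OF D(1)] by auto
  have 4: "D \<inter> Q \<noteq> {}" "?Rest \<inter> Q \<noteq> {}" using n D 2 by auto
  show False using connectedD[OF Q(1) 1 3 2] 4 by simp
qed

definition hit_dist :: "real \<Rightarrow> real" where "hit_dist s = Inf {t. 0 \<le> t \<and> rcis t s \<in> closure E}"
definition hit :: "real \<Rightarrow> complex" where "hit s = rcis (hit_dist s) s"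

lemma
  shows hit_dist_nonneg: "0 \<le> hit_dist s" and hit_closure: "hit s \<in> closure E"
    and hit_dist_le: "0 \<le> t \<Longrightarrow> rcis t s \<in> closure E \<Longrightarrow> hit_dist s \<le> t"
proof -
  let ?T = "{t. 0 \<le> t \<and> rcis t s \<in> closure E}"
  have "?T = {0..} \<inter> (\<lambda>t. rcis t s) -` closure E" by auto
  also have "closed \<dots>"
    by (intro closed_Int closed_vimage) (auto simp: rcis_def intro!: continuous_intros)
  finally have cl: "closed ?T" .
  have ne: "?T \<noteq> {}" using dark[of s] closure_subset by blast
  have bd: "bdd_below ?T" by (rule bdd_belowI[of _ 0]) simp
  have "hit_dist s \<in> ?T" unfolding hit_dist_def using closed_contains_Inf[OF ne bd cl] .
  then show "0 \<le> hit_dist s" "hit s \<in> closure E" by (auto simp: hit_def)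
  show "hit_dist s \<le> t" if "0 \<le> t" "rcis t s \<in> closure E" for t
    unfolding hit_dist_def using bd that by (intro cInf_lower) auto
qed

lemma hit_dist_pos: "0 < hit_dist s"
  using hit_dist_nonneg[of s] hit_closure[of s] origin by (cases "hit_dist s = 0") (auto simp: hit_def)

lemma norm_hit: "cmod (hit s) = hit_dist s"
  using hit_dist_pos[of s] by (simp add: hit_def)

lemma before_front: "0 \<le> t \<Longrightarrow> t < hit_dist s \<Longrightarrow> rcis t s \<notin> E"
  using hit_dist_le closure_subset by fastforce

lemma hit_frontier: "hit s \<in> frontier E"
proof -
  have "hit s \<notin> E"
  proof
    assume "hit s \<in> E"
    then obtain e where e: "e > 0" "ball (hit s) e \<subseteq> E" using open_E open_contains_ball by blast
    define t where "t = hit_dist s - min (e / 2) (hit_dist s / 2)"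
    have t: "0 \<le> t" "t < hit_dist s" "hit_dist s - t < e" using e hit_dist_pos[of s] by (auto simp: t_def min_def)
    have "dist (hit s) (rcis t s) = hit_dist s - t"
    proof -
      have "hit s - rcis t s = rcis (hit_dist s - t) s" by (simp add: hit_def rcis_def algebra_simps)
      then show ?thesis using t by (simp add: dist_norm)
    qed
    then have "rcis t s \<in> ball (hit s) e" using t by simp
    then show False using before_front[OF t(1,2)] e by blast
  qed
  then show ?thesis using hit_closure open_E by (simp add: frontier_def interior_open)
qed

lemma upto_front: "0 \<le> t \<Longrightarrow> t \<le> hit_dist s \<Longrightarrow> rcis t s \<notin> E"
  using before_front frontier_not_in[OF hit_frontier[of s]] by (cases "t = hit_dist s") (auto simp: hit_def)

lemma closure_beyond_front:
  assumes "z \<in> closure E" "z = rcis (cmod z) s" "z \<noteq> hit s" shows "hit_dist s < cmod z"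
  using hit_dist_le[of "cmod z" s] assms by (metis hit_def norm_ge_zero order_le_imp_less_or_eq)

text \<open>A free ray at \<open>hit s\<close> that makes the angle \<open>\<tau>\<close> with the line of sight, to the side \<open>\<sigma>\<close>.\<close>

definition turn :: "real \<Rightarrow> real \<Rightarrow> real \<Rightarrow> bool" where
  "turn \<sigma> s \<tau> \<longleftrightarrow> 0 < \<tau> \<and> \<tau> < pi \<and> (\<forall>t\<ge>0. hit s + rcis t (s + \<sigma> * \<tau>) \<notin> E)"

text \<open>
  A free ray that continues the line of sight, or runs back through the origin, would make the ray
  from the origin in this direction miss \<open>E\<close>.
\<close>

lemma turn_cases: obtains \<sigma> \<tau> where "\<sigma> \<in> {1, - 1}" "turn \<sigma> s \<tau>"
proof -
  obtain a where a: "\<And>t. t \<ge> 0 \<Longrightarrow> hit s + rcis t a \<notin> E" using free_ray[OF hit_frontier] by blast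
  define b where "b = Arg (cis (a - s))"
  have "cis b = cis (a - s)" unfolding b_def by (subst cis_Arg) (simp_all add: sgn_eq)
  then have "cis (s + b) = cis a" by (simp flip: cis_mult) (simp add: cis_mult)
  then have free: "hit s + rcis t (s + b) \<notin> E" if "t \<ge> 0" for t using a[OF that] by (simp add: rcis_def)
  have b: "- pi < b" "b \<le> pi" using Arg_bounded b_def by auto
  have "b \<noteq> 0"
  proof
    assume "b = 0"
    obtain t where t: "t \<ge> 0" "rcis t s \<in> E" using dark by blast
    then have "hit_dist s \<le> t" using before_front[of t s] by linarith
    moreover have "hit s + rcis (t - hit_dist s) s = rcis t s" by (simp add: hit_def rcis_def algebra_simps)
    ultimately show False using free[of "t - hit_dist s"] t \<open>b = 0\<close> by simp
  qed
  moreover have "b \<noteq> pi"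
  proof
    assume "b = pi"
    obtain t where t: "t \<ge> 0" "rcis t (s + pi) \<in> E" using dark by blast
    have "hit s + rcis (t + hit_dist s) (s + pi) = rcis t (s + pi)"
      by (simp add: hit_def rcis_def algebra_simps flip: cis_mult)
    then show False using free[of "t + hit_dist s"] t \<open>b = pi\<close> hit_dist_pos[of s] by simp
  qed
  ultimately show thesis
    using that[of 1 b] that[of "- 1" "- b"] b free unfolding turn_def by fastforce
qed

text \<open>The argument on \<open>E\<close> that is cut along the segment to \<open>hit s\<close> and a free ray there.\<close>

definition branch :: "real \<Rightarrow> real \<Rightarrow> real \<Rightarrow> complex \<Rightarrow> real" where
  "branch \<sigma> s \<tau> z = s + \<sigma> * bent_arg (hit_dist s) \<tau> (tilt \<sigma> s z)"

context
  fixes \<sigma> s \<tau> assumes sgn: "\<sigma> \<in> {1, - 1}" and turn: "turn \<sigma> s \<tau>"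
begin

lemma turn_bounds: "0 < \<tau>" "\<tau> < pi" "0 < hit_dist s"
  using turn hit_dist_pos by (auto simp: turn_def)

lemma off_cut: assumes "z \<in> E" shows "\<not> on_cut (hit_dist s) \<tau> (tilt \<sigma> s z)"
proof
  let ?w = "tilt \<sigma> s z"
  assume "on_cut (hit_dist s) \<tau> ?w"
  then consider "0 \<le> Im ?w" "side (hit_dist s) \<tau> ?w = 0" | "Im ?w = 0" "0 \<le> Re ?w" "Re ?w \<le> hit_dist s"
    unfolding on_cut_def by blast
  then show False
  proof cases
    case 1
    have st: "sin \<tau> > 0" using turn_bounds sin_gt_zero by simp
    define t where "t = Im ?w / sin \<tau>"
    have t: "t \<ge> 0" using 1 st t_def by simp
    have im: "Im ?w = t * sin \<tau>" using st t_def by simp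
    have "(Re ?w - hit_dist s) * sin \<tau> = Im ?w * cos \<tau>" using 1(2) unfolding side_def by linarith
    also have "\<dots> = (t * cos \<tau>) * sin \<tau>" unfolding im by (simp only: mult_ac)
    finally have "Re ?w - hit_dist s = t * cos \<tau>" using st by (metis mult_right_cancel less_irrefl)
    then have re: "Re ?w = hit_dist s + t * cos \<tau>" by simp
    have "z = cis s * Complex (hit_dist s + t * cos \<tau>) (\<sigma> * (t * sin \<tau>))"
      using untilt[OF sgn, of z s] im re by simp
    also have "\<dots> = hit s + rcis t (s + \<sigma> * \<tau>)"
      using sgn by (auto simp: hit_def complex_eq_iff cos_add sin_add cos_diff sin_diff algebra_simps)
    finally show False using turn assms t by (simp add: turn_def)
  next
    case 2
    have "z = cis s * Complex (Re ?w) 0" using untilt[OF sgn, of z s] 2 by simp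
    also have "\<dots> = rcis (Re ?w) s" by (simp add: complex_eq_iff)
    finally show False using upto_front[of "Re ?w" s] 2 assms by simp
  qed
qed

lemma nonzero_E: "z \<in> E \<Longrightarrow> z \<noteq> 0"
  using origin closure_subset by blast

lemma isCont_tilted:
  assumes "\<not> on_cut (hit_dist s) \<tau> (tilt \<sigma> s z)"
  shows "isCont (\<lambda>x. bent_arg (hit_dist s) \<tau> (tilt \<sigma> s x)) z"
proof -
  have "isCont (tilt \<sigma> s) z" using continuous_tilt[of UNIV] by (simp add: continuous_on_eq_continuous_at)
  then show ?thesis using isCont_bent_arg[OF turn_bounds assms] by (rule isCont_o2)
qed

lemma branch_continuous: "continuous_on E (branch \<sigma> s \<tau>)"
proof -
  have "isCont (\<lambda>x. bent_arg (hit_dist s) \<tau> (tilt \<sigma> s x)) z" if "z \<in> E" for z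
    by (rule isCont_tilted[OF off_cut[OF that]])
  then have "continuous_on E (\<lambda>x. bent_arg (hit_dist s) \<tau> (tilt \<sigma> s x))"
    by (simp add: continuous_at_imp_continuous_on)
  then show ?thesis unfolding branch_def by (intro continuous_intros)
qed

lemma branch_cis: assumes "z \<in> E" shows "cis (branch \<sigma> s \<tau> z) = sgn z"
proof -
  let ?w = "tilt \<sigma> s z"
  have z: "z \<noteq> 0" "?w \<noteq> 0" using nonzero_E assms tilt_nonzero[OF sgn] by auto
  have n: "cmod ?w = cmod z" using tilt_inner[OF sgn, of s z z] by (simp add: norm_eq_sqrt_inner)
  have c: "cis (bent_arg (hit_dist s) \<tau> ?w) = sgn ?w" using cis_bent_arg z by blast
  then have re: "cos (bent_arg (hit_dist s) \<tau> ?w) = Re ?w / cmod z" "sin (bent_arg (hit_dist s) \<tau> ?w) = Im ?w / cmod z"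
    by (simp_all add: complex_eq_iff sgn_eq n)
  have "cis (\<sigma> * bent_arg (hit_dist s) \<tau> ?w) = Complex (Re ?w) (\<sigma> * Im ?w) / cmod z"
    using sgn re by (auto simp: complex_eq_iff)
  then have "cis (branch \<sigma> s \<tau> z) = cis s * Complex (Re ?w) (\<sigma> * Im ?w) / cmod z"
    unfolding branch_def by (simp flip: cis_mult)
  then show ?thesis using untilt[OF sgn, of z s] by (simp add: sgn_eq)
qed

lemma branch_bound:
  assumes "z \<in> E"
  shows "\<sigma> * (branch \<sigma> s \<tau> z - s) < \<tau>" "- 2 * pi < \<sigma> * (branch \<sigma> s \<tau> z - s)"
proof -
  have "\<sigma> * (branch \<sigma> s \<tau> z - s) = bent_arg (hit_dist s) \<tau> (tilt \<sigma> s z)"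
    using sgn by (auto simp: branch_def)
  then show "\<sigma> * (branch \<sigma> s \<tau> z - s) < \<tau>" "- 2 * pi < \<sigma> * (branch \<sigma> s \<tau> z - s)"
    using bent_arg_bounds[OF turn_bounds off_cut[OF assms]] by auto
qed

end

text \<open>
  The cut at any single angle provides a global argument on \<open>E\<close>, so no component winds around the
  origin.
\<close>

lemma angle_exists: "\<exists>g. continuous_on E g \<and> (\<forall>z\<in>E. cis (g z) = sgn z) \<and> bounded (g ` E)"
proof -
  obtain \<sigma> \<tau> where *: "\<sigma> \<in> {1, - 1}" "turn \<sigma> 0 \<tau>" by (rule turn_cases)
  have "\<bar>branch \<sigma> 0 \<tau> z\<bar> \<le> 2 * pi" if "z \<in> E" for z
    using branch_bound[OF * that] turn_bounds[OF *] *(1) by auto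
  then have "bounded (branch \<sigma> 0 \<tau> ` E)" unfolding bounded_iff by auto
  then show ?thesis using branch_continuous[OF *] branch_cis[OF *] by blast
qed

definition ang :: "complex \<Rightarrow> real" where
  "ang = (SOME g. continuous_on E g \<and> (\<forall>z\<in>E. cis (g z) = sgn z) \<and> bounded (g ` E))"

lemma
  shows ang_continuous: "continuous_on E ang" and ang_cis: "z \<in> E \<Longrightarrow> cis (ang z) = sgn z"
    and ang_bounded: "bounded (ang ` E)"
  using someI_ex[OF angle_exists] unfolding ang_def by blast+

section \<open>Sheets: pieces lifted to the universal cover of the punctured plane\<close>

text \<open>
  The pair \<open>(D, k)\<close> stands for the lift of \<open>D\<close> on which the argument is \<open>ang + 2 * pi * k\<close>. The
  universal cover is represented by pairs of a point and one of its arguments; taking closures in it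
  keeps track of the argument with which a frontier point is approached.
\<close>

definition label :: "complex set \<times> int \<Rightarrow> complex \<Rightarrow> real" where
  "label K z = ang z + 2 * pi * of_int (snd K)"

definition sheet :: "complex set \<times> int \<Rightarrow> (complex \<times> real) set" where
  "sheet K = closure ((\<lambda>z. (z, label K z)) ` fst K)"

text \<open>Empty for pairs that are not lifts of pieces, so that only lifts of pieces can be hidden.\<close>

definition cov :: "complex set \<times> int \<Rightarrow> real set" where
  "cov K = (if fst K \<in> X then snd ` sheet K else {})"

lemma small_period: "\<bar>2 * pi * real_of_int m\<bar> < 2 \<Longrightarrow> m = 0"
proof (rule ccontr)
  assume a: "\<bar>2 * pi * real_of_int m\<bar> < 2" and "m \<noteq> 0"
  then have "\<bar>real_of_int m\<bar> \<ge> 1" by linarith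
  then have "2 * pi \<le> \<bar>2 * pi * real_of_int m\<bar>" by (simp add: abs_mult)
  then show False using pi_gt3 a by linarith
qed

lemma label_continuous: "continuous_on E (label K)"
  unfolding label_def by (intro continuous_intros ang_continuous)

lemma label_cis: "z \<in> E \<Longrightarrow> cis (label K z) = sgn z"
  using ang_cis[of z] by (simp add: label_def complex_eq_iff)
    (simp add: cos_add sin_add cos_int_2pin sin_int_2pin)

lemma sheet_limit:
  assumes "(z, t) \<in> sheet K"
  obtains w where "\<forall>n. w n \<in> fst K" "w \<longlonglongrightarrow> z" "(\<lambda>n. label K (w n)) \<longlonglongrightarrow> t"
proof -
  obtain f where f: "\<And>n. f n \<in> (\<lambda>z. (z, label K z)) ` fst K" "f \<longlonglongrightarrow> (z, t)"
    using assms unfolding sheet_def closure_sequential by blast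
  define w where "w n = fst (f n)" for n
  have fw: "f n = (w n, label K (w n))" "w n \<in> fst K" for n using f(1)[of n] by (auto simp: w_def)
  have "w \<longlonglongrightarrow> z" using tendsto_fst[OF f(2)] by (simp add: fw)
  moreover have "(\<lambda>n. label K (w n)) \<longlonglongrightarrow> t" using tendsto_snd[OF f(2)] by (simp add: fw)
  ultimately show thesis using that fw by blast
qed

lemma sheetI:
  assumes "\<And>n. w n \<in> fst K" "w \<longlonglongrightarrow> z" "(\<lambda>n. label K (w n)) \<longlonglongrightarrow> t"
  shows "(z, t) \<in> sheet K"
  unfolding sheet_def closure_sequential
  by (rule exI[of _ "\<lambda>n. (w n, label K (w n))"]) (use assms in \<open>auto intro: tendsto_Pair\<close>)

lemma sheet_shift: "(z, t + 2 * pi * of_int m) \<in> sheet (D, k + m) \<longleftrightarrow> (z, t) \<in> sheet (D, k)"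
proof -
  have "(z, t + 2 * pi * of_int m) \<in> sheet (D, k + m)" if zt: "(z, t) \<in> sheet (D, k)" for t k m
  proof -
    obtain w where w: "\<forall>n. w n \<in> fst (D, k)" "w \<longlonglongrightarrow> z" "(\<lambda>n. label (D, k) (w n)) \<longlonglongrightarrow> t"
      by (rule sheet_limit[OF zt])
    have "(\<lambda>n. label (D, k) (w n) + 2 * pi * of_int m) \<longlonglongrightarrow> t + 2 * pi * of_int m"
      by (intro tendsto_intros w)
    then have "(\<lambda>n. label (D, k + m) (w n)) \<longlonglongrightarrow> t + 2 * pi * of_int m"
      by (simp add: label_def algebra_simps)
    then show ?thesis using w by (intro sheetI) auto
  qed
  from this[of t k m] this[of "t + 2 * pi * of_int m" "k + m" "- m"] show ?thesis by auto
qed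

context
  fixes K :: "complex set \<times> int" assumes piece: "fst K \<in> X"
begin

lemma compact_sheet: "compact (sheet K)"
proof -
  obtain B where B: "\<And>z. z \<in> E \<Longrightarrow> \<bar>ang z\<bar> \<le> B" using ang_bounded unfolding bounded_iff by auto
  have "label K ` fst K \<subseteq> cball 0 (B + \<bar>2 * pi * of_int (snd K)\<bar>)"
    using B piece_subset[OF piece] unfolding label_def by (force simp: abs_mult intro: abs_triangle_ineq[THEN order_trans])
  then have "bounded (label K ` fst K)" using bounded_cball bounded_subset by blast
  moreover have "bounded (fst K)" using bounded_E piece_subset[OF piece] bounded_subset by blast
  ultimately have "bounded (fst K \<times> label K ` fst K)" by (rule bounded_Times[rotated])
  then have "bounded ((\<lambda>z. (z, label K z)) ` fst K)" by (rule bounded_subset) auto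
  then show ?thesis by (simp add: sheet_def compact_closure)
qed

lemma connected_sheet: "connected (sheet K)"
  unfolding sheet_def
  by (intro connected_imp_connected_closure connected_continuous_image continuous_on_Pair continuous_on_id
      continuous_on_subset[OF label_continuous piece_subset[OF piece]] connected_piece piece)

lemma sheet_closure:
  assumes "(z, t) \<in> sheet K" shows "z \<in> closure (fst K)" "z \<in> closure E"
proof -
  obtain w where w: "\<forall>n. w n \<in> fst K" "w \<longlonglongrightarrow> z" "(\<lambda>n. label K (w n)) \<longlonglongrightarrow> t"
    by (rule sheet_limit[OF assms])
  then show "z \<in> closure (fst K)" unfolding closure_sequential by blast
  then show "z \<in> closure E" using closure_mono[OF piece_subset[OF piece]] by blast
qed

lemma sheet_polar:
  assumes "(z, t) \<in> sheet K" shows "z = rcis (cmod z) t"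
proof -
  obtain w where w: "\<forall>n. w n \<in> fst K" "w \<longlonglongrightarrow> z" "(\<lambda>n. label K (w n)) \<longlonglongrightarrow> t"
    by (rule sheet_limit[OF assms])
  have "w n = of_real (cmod (w n)) * cis (label K (w n))" for n
  proof -
    have "w n \<in> E" using w(1) piece_subset[OF piece] by blast
    from label_cis[OF this, of K] show ?thesis by (cases "w n = 0") (simp_all add: sgn_eq)
  qed
  moreover have "(\<lambda>n. of_real (cmod (w n)) * cis (label K (w n))) \<longlonglongrightarrow> of_real (cmod z) * cis t"
    unfolding cis_conv_exp by (intro tendsto_intros w)
  ultimately have "w \<longlonglongrightarrow> of_real (cmod z) * cis t" by simp
  then show ?thesis using w(2) LIMSEQ_unique by (auto simp: rcis_def)
qed

text \<open>
  Near a frontier point \<open>E\<close> lies in a connected subset \<open>Q\<close> of \<open>E\<close> that is small enough to carry the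
  local branch \<open>\<Lambda>\<close> of the argument. So \<open>Q\<close> lies in one piece, and on it the label differs from \<open>\<Lambda>\<close>
  by a constant multiple of \<open>2 * pi\<close>, which is \<open>0\<close> because the sheet passes through \<open>(p, t)\<close>.
\<close>

lemma label_near_frontier:
  assumes p: "p \<in> frontier E" "(p, t) \<in> sheet K" and \<epsilon>: "\<epsilon> > 0"
  obtains \<delta> where "\<delta> > 0" "\<And>z. z \<in> E \<Longrightarrow> dist p z < \<delta> \<Longrightarrow> z \<in> fst K \<and> \<bar>label K z - t\<bar> < \<epsilon>"
proof -
  define \<Lambda> where "\<Lambda> z = t + Arg (z * cis (- t))" for z
  have pp: "p = rcis (cmod p) t" by (rule sheet_polar[OF p(2)])
  have p0: "cmod p > 0" using origin p(1) by (auto simp: frontier_def)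
  have pc: "p * cis (- t) = of_real (cmod p)" by (subst pp) (simp add: rcis_def cis_mult mult.assoc)
  have "p * cis (- t) \<notin> \<real>\<^sub>\<le>\<^sub>0" unfolding pc using p0 by (simp add: complex_nonpos_Reals_iff)
  then have "isCont (\<lambda>z. Arg (z * cis (- t))) p"
    by (intro isCont_o2[where f = "\<lambda>z. z * cis (- t)" and g = Arg, OF _ continuous_at_Arg]) (intro continuous_intros)
  then have cont: "isCont \<Lambda> p" unfolding \<Lambda>_def by (intro continuous_intros)
  have "\<Lambda> p = t" using p0 by (simp add: \<Lambda>_def pc Arg_eq_0)
  then obtain \<eta>1 where \<eta>1: "\<eta>1 > 0" "\<And>z. dist z p < \<eta>1 \<Longrightarrow> dist (\<Lambda> z) t < min \<epsilon> 1"
    using cont \<epsilon> unfolding continuous_at_eps_delta by (metis min_less_iff_conj zero_less_one)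
  define \<eta> where "\<eta> = min \<eta>1 (cmod p)"
  have \<eta>: "\<eta> > 0" using \<eta>1 p0 by (simp add: \<eta>_def)
  obtain \<delta> Q where Q: "\<delta> > 0" "connected Q" "E \<inter> ball p \<delta> \<subseteq> Q" "Q \<subseteq> E \<inter> ball p \<eta>"
    using one_sided[OF p(1) \<eta>] by blast
  obtain w where w: "\<forall>n. w n \<in> fst K" "w \<longlonglongrightarrow> p" "(\<lambda>n. label K (w n)) \<longlonglongrightarrow> t"
    by (rule sheet_limit[OF p(2)])
  have "\<forall>\<^sub>F n in sequentially. dist (w n) p < \<delta> \<and> dist (label K (w n)) t < 1"
    using tendstoD[OF w(2) Q(1)] tendstoD[OF w(3), of 1] by (simp add: eventually_conj)
  then obtain w0 where w0: "w0 \<in> fst K" "dist w0 p < \<delta>" "dist (label K w0) t < 1"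
    using w(1) eventually_happens'[OF sequentially_bot] by blast
  have w0Q: "w0 \<in> Q" using w0 Q(3) piece_subset[OF piece] by (auto simp: dist_commute)
  have QD: "Q \<subseteq> fst K" using connected_in_piece[OF Q(2) _ piece w0(1) w0Q] Q(4) by blast
  have half: "z * cis (- t) \<notin> \<real>\<^sub>\<le>\<^sub>0" if "z \<in> Q" for z
  proof
    assume "z * cis (- t) \<in> \<real>\<^sub>\<le>\<^sub>0"
    then have "Re (z * cis (- t)) \<le> 0" by (simp add: complex_nonpos_Reals_iff)
    then have "cmod p \<le> Re (p * cis (- t)) - Re (z * cis (- t))" by (simp add: pc)
    also have "\<dots> = Re ((p - z) * cis (- t))" by (simp add: algebra_simps)
    also have "\<dots> \<le> cmod (p - z)" by (rule order_trans[OF complex_Re_le_cmod]) (simp add: norm_mult)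
    finally show False using that Q(4) by (auto simp: \<eta>_def dist_norm)
  qed
  have "\<exists>m :: int. \<forall>z\<in>Q. label K z = \<Lambda> z + 2 * pi * of_int m"
  proof (rule continuous_args_differ_by_period[of Q "label K" \<Lambda>])
    show "connected Q" by fact
    show "Q \<noteq> {}" using w0Q by blast
    show "continuous_on Q (label K)" using label_continuous Q(4) continuous_on_subset by blast
    show "continuous_on Q \<Lambda>"
    proof -
      have "isCont (\<lambda>z. Arg (z * cis (- t))) z" if "z \<in> Q" for z
        by (intro isCont_o2[where f = "\<lambda>z. z * cis (- t)" and g = Arg, OF _ continuous_at_Arg[OF half[OF that]]])
          (intro continuous_intros)
      then have "continuous_on Q (\<lambda>z. Arg (z * cis (- t)))" by (simp add: continuous_at_imp_continuous_on)
      then show ?thesis unfolding \<Lambda>_def by (rule continuous_on_add[OF continuous_on_const])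
    qed
    show "cis (label K z) = cis (\<Lambda> z)" if "z \<in> Q" for z
    proof -
      have "z * cis (- t) \<noteq> 0" using half[OF that] by auto
      then have "cis (\<Lambda> z) = cis t * sgn (z * cis (- t))" by (simp add: \<Lambda>_def cis_Arg flip: cis_mult)
      also have "\<dots> = sgn z" by (simp add: sgn_mult cis_mult mult.left_commute sgn_eq[of "cis _"])
      finally show ?thesis using label_cis[of z K] that Q(4) by auto
    qed
  qed
  then obtain m :: int where m: "\<And>z. z \<in> Q \<Longrightarrow> label K z = \<Lambda> z + 2 * pi * of_int m" by blast
  have near: "dist (\<Lambda> z) t < min \<epsilon> 1" if "z \<in> Q" for z
    using that Q(4) by (intro \<eta>1) (auto simp: \<eta>_def dist_commute)
  have "\<bar>2 * pi * real_of_int m\<bar> < 2" 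
  proof -
    have "\<bar>x\<bar> < 2" if "\<bar>a\<bar> < 1" "\<bar>a + x\<bar> < 1" for a x :: real using that by linarith
    from this[of "\<Lambda> w0 - t"] show ?thesis using m[OF w0Q] near[OF w0Q] w0(3) by (simp add: dist_real_def algebra_simps)
  qed
  then have "m = 0" by (rule small_period)
  show thesis
  proof (rule that[OF Q(1)])
    fix z assume "z \<in> E" "dist p z < \<delta>"
    then have "z \<in> Q" using Q(3) by auto
    then show "z \<in> fst K \<and> \<bar>label K z - t\<bar> < \<epsilon>"
      using QD m[of z] near[of z] \<open>m = 0\<close> by (auto simp: dist_real_def)
  qed
qed

end

text \<open>Closures of different sheets are disjoint over the frontier: this is why a front is unique.\<close>

lemma sheet_unique:
  assumes p: "p \<in> frontier E" and K: "fst K \<in> X" "(p, t) \<in> sheet K" and L: "fst L \<in> X" "(p, t) \<in> sheet L"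
  shows "K = L"
proof -
  obtain \<delta> where \<delta>: "\<delta> > 0" "\<And>z. z \<in> E \<Longrightarrow> dist p z < \<delta> \<Longrightarrow> z \<in> fst K \<and> \<bar>label K z - t\<bar> < 1"
    using label_near_frontier[OF K(1) p K(2), of 1] by auto
  obtain \<delta>' where \<delta>': "\<delta>' > 0" "\<And>z. z \<in> E \<Longrightarrow> dist p z < \<delta>' \<Longrightarrow> z \<in> fst L \<and> \<bar>label L z - t\<bar> < 1"
    using label_near_frontier[OF L(1) p L(2), of 1] by auto
  have "p \<in> closure E" using p by (simp add: frontier_def)
  then obtain z where z: "z \<in> E" "dist z p < min \<delta> \<delta>'"
    using \<delta>(1) \<delta>'(1) unfolding closure_approachable by (metis min_less_iff_conj)
  have zK: "z \<in> fst K" "\<bar>label K z - t\<bar> < 1" and zL: "z \<in> fst L" "\<bar>label L z - t\<bar> < 1"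
    using \<delta>(2)[of z] \<delta>'(2)[of z] z by (auto simp: dist_commute)
  have "fst K = fst L" using disjoint_pieces[OF K(1) L(1)] zK zL by blast
  moreover have "\<bar>2 * pi * real_of_int (snd K - snd L)\<bar> < 2"
    using zK(2) zL(2) by (simp add: label_def right_diff_distrib)
  then have "snd K = snd L" using small_period[of "snd K - snd L"] by simp
  ultimately show ?thesis by (simp add: prod_eq_iff)
qed

lemma front_exists: "\<exists>K. fst K \<in> X \<and> (hit s, s) \<in> sheet K"
proof -
  have "hit s \<in> (\<Union>D\<in>X. closure D)"
  proof -
    have "closed (\<Union>D\<in>X. closure D)" using finite_X by (intro closed_UN) auto
    moreover have "E \<subseteq> (\<Union>D\<in>X. closure D)" unfolding union using closure_subset by blast
    ultimately show ?thesis using closure_minimal hit_closure by blast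
  qed
  then obtain D where D: "D \<in> X" "hit s \<in> closure D" by blast
  then obtain w where w: "\<And>n. w n \<in> D" "w \<longlonglongrightarrow> hit s" unfolding closure_sequential by blast
  have "bounded (range (\<lambda>n. ang (w n)))"
    by (rule bounded_subset[OF ang_bounded]) (use w piece_subset[OF D(1)] in blast)
  then obtain a f where f: "strict_mono f" "((\<lambda>n. ang (w n)) \<circ> f) \<longlonglongrightarrow> a"
    using bounded_imp_convergent_subsequence by blast
  have "(hit s, a) \<in> sheet (D, 0)"
  proof (rule sheetI)
    show "(w \<circ> f) n \<in> fst (D, 0)" for n using w by simp
    show "(w \<circ> f) \<longlonglongrightarrow> hit s" using w(2) f(1) by (rule LIMSEQ_subseq_LIMSEQ)
    show "(\<lambda>n. label (D, 0) ((w \<circ> f) n)) \<longlonglongrightarrow> a" using f(2) by (simp add: label_def o_def)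
  qed
  moreover have "rcis (hit_dist s) s = rcis (hit_dist s) a"
    using sheet_polar[of "(D, 0)" "hit s" a] D(1) calculation norm_hit by (simp add: hit_def)
  then obtain m :: int where "s = a + 2 * pi * of_int m" using rcis_eq_period[OF hit_dist_pos] by blast
  ultimately have "(hit s, s) \<in> sheet (D, 0 + m)" using sheet_shift by blast
  then show ?thesis using D(1) by auto
qed

definition front :: "real \<Rightarrow> complex set \<times> int" where
  "front s = (SOME K. fst K \<in> X \<and> (hit s, s) \<in> sheet K)"

lemma fst_front: "fst (front s) \<in> X" and front_sheet: "(hit s, s) \<in> sheet (front s)"
  using someI_ex[OF front_exists[of s]] unfolding front_def by blast+

lemma front_eqI: "fst K \<in> X \<Longrightarrow> (hit s, s) \<in> sheet K \<Longrightarrow> front s = K"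
  using sheet_unique[OF hit_frontier fst_front front_sheet] by blast

lemma hit_shift: "hit (s + 2 * pi * of_int m) = hit s"
proof -
  have "cis (s + 2 * pi * of_int m) = cis s"
    by (simp add: complex_eq_iff cos_add sin_add cos_int_2pin sin_int_2pin)
  then have "rcis t (s + 2 * pi * of_int m) = rcis t s" for t by (simp add: rcis_def)
  then show ?thesis by (simp add: hit_def hit_dist_def)
qed

lemma front_shift: "front (s + 2 * pi * of_int m) = (fst (front s), snd (front s) + m)"
  by (rule front_eqI) (use fst_front front_sheet sheet_shift[of "hit s" s m "fst (front s)" "snd (front s)"] hit_shift in auto)

section \<open>A free ray as a cut between the sheets\<close>

context
  fixes \<sigma> s \<tau> assumes sgn: "\<sigma> \<in> {1, - 1}" and turn: "turn \<sigma> s \<tau>"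
begin

text \<open>
  The cut argument is the label of exactly one lift of each piece. For \<open>\<sigma> = 1\<close> this lift and those
  below it are the sheets to the right of the lifted cut.
\<close>

definition behind :: "complex set \<times> int \<Rightarrow> bool" where
  "behind K \<longleftrightarrow> fst K \<in> X \<and> (\<forall>z\<in>fst K. \<sigma> * (label K z - s) \<le> \<sigma> * (branch \<sigma> s \<tau> z - s))"

lemma branch_period:
  assumes K: "fst K \<in> X"
  shows "\<exists>m :: int. \<forall>z\<in>fst K. branch \<sigma> s \<tau> z = label K z + 2 * pi * of_int m"
proof (rule continuous_args_differ_by_period)
  note sub = piece_subset[OF K]
  show "connected (fst K)" "fst K \<noteq> {}" using connected_piece nonempty_piece K by auto
  show "continuous_on (fst K) (branch \<sigma> s \<tau>)" "continuous_on (fst K) (label K)"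
    using branch_continuous[OF sgn turn] label_continuous sub continuous_on_subset by blast+
  show "cis (branch \<sigma> s \<tau> z) = cis (label K z)" if "z \<in> fst K" for z
  proof -
    have "z \<in> E" using that sub by blast
    then show ?thesis using branch_cis[OF sgn turn] label_cis by simp
  qed
qed

text \<open>Label and cut argument differ by full turns, so a sheet on the other side is off by at least one.\<close>

lemma behind_cases:
  assumes K: "fst K \<in> X" and n: "\<not> behind K" and z: "z \<in> fst K"
  shows "\<sigma> * (branch \<sigma> s \<tau> z - s) \<le> \<sigma> * (label K z - s) - 2 * pi"
proof -
  obtain m :: int where m: "\<And>z. z \<in> fst K \<Longrightarrow> branch \<sigma> s \<tau> z = label K z + 2 * pi * of_int m"
    using branch_period[OF K] by blast
  have e: "\<sigma> * (branch \<sigma> s \<tau> z - s) = \<sigma> * (label K z - s) + 2 * pi * of_int (if \<sigma> = 1 then m else - m)" if "z \<in> fst K" for z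
    using m[OF that] sgn by (auto simp: algebra_simps)
  define j where "j = (if \<sigma> = 1 then m else - m)"
  have "j < 0"
  proof (rule ccontr)
    assume "\<not> j < 0"
    then have "0 \<le> 2 * pi * real_of_int j" by simp
    then show False using n K e by (auto simp: behind_def j_def)
  qed
  then have "2 * pi * real_of_int j \<le> 2 * pi * (- 1)" by (intro mult_left_mono) auto
  then show ?thesis using e[OF z] by (simp add: j_def)
qed

text \<open>
  Neither the free ray nor the line of sight, traversed backwards, enters \<open>E\<close> at \<open>hit s\<close>; so both
  directions are outside the open half-plane that \<open>E\<close> fills to first order.
\<close>

lemma normal_at_turn:
  obtains n where "n \<noteq> 0"
    and "\<forall>v. n \<bullet> v < 0 \<longrightarrow> (\<exists>\<epsilon>>0. \<forall>t. 0 < t \<and> t < \<epsilon> \<longrightarrow> hit s + of_real t * v \<in> E)"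
    and "Re (tilt \<sigma> s n) \<le> 0" and "Re (tilt \<sigma> s n) * cos \<tau> + Im (tilt \<sigma> s n) * sin \<tau> \<ge> 0"
proof -
  obtain n where n: "n \<noteq> 0" "\<forall>v. n \<bullet> v < 0 \<longrightarrow> (\<exists>\<epsilon>>0. \<forall>t. 0 < t \<and> t < \<epsilon> \<longrightarrow> hit s + of_real t * v \<in> E)"
    using normal[OF hit_frontier[of s]] by blast
  let ?N = "tilt \<sigma> s n"
  have free: "n \<bullet> v \<ge> 0" if "\<epsilon>' > 0" "\<And>t. 0 < t \<Longrightarrow> t < \<epsilon>' \<Longrightarrow> hit s + of_real t * v \<notin> E" for v \<epsilon>'
  proof (rule ccontr)
    assume "\<not> ?thesis"
    then have "n \<bullet> v < 0" by simp
    then obtain \<epsilon> where \<epsilon>: "\<epsilon> > 0" "\<forall>t. 0 < t \<and> t < \<epsilon> \<longrightarrow> hit s + of_real t * v \<in> E" using n(2) by blast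
    define t where "t = min \<epsilon> \<epsilon>' / 2"
    have "0 < t" "t < \<epsilon>" "t < \<epsilon>'" using \<epsilon> that(1) by (auto simp: t_def min_def)
    then show False using \<epsilon>(2) that(2) by blast
  qed
  have "n \<bullet> (- cis s) \<ge> 0"
  proof (rule free[OF hit_dist_pos[of s]])
    fix t assume "0 < t" "t < hit_dist s"
    then show "hit s + of_real t * - cis s \<notin> E"
      using upto_front[of "hit_dist s - t" s] by (simp add: hit_def rcis_def algebra_simps)
  qed
  then have "?N \<bullet> tilt \<sigma> s (- cis s) \<ge> 0" by (simp add: tilt_inner[OF sgn])
  moreover have "tilt \<sigma> s (- cis s) = - 1"
    using tilt_rcis[OF sgn, of s "- 1" s] by (simp add: rcis_def)
  ultimately have N1: "Re ?N \<le> 0" by (simp add: inner_complex_def)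
  have "n \<bullet> cis (s + \<sigma> * \<tau>) \<ge> 0"
    by (rule free[of 1]) (use turn in \<open>auto simp: turn_def rcis_def\<close>)
  then have "?N \<bullet> tilt \<sigma> s (cis (s + \<sigma> * \<tau>)) \<ge> 0" by (simp add: tilt_inner[OF sgn])
  moreover have "tilt \<sigma> s (cis (s + \<sigma> * \<tau>)) = cis \<tau>"
    using sgn by (auto simp: tilt_cis)
  ultimately have N2: "Re ?N * cos \<tau> + Im ?N * sin \<tau> \<ge> 0" by (simp add: inner_complex_def)
  show thesis by (rule that[OF n N1 N2])
qed

text \<open>
  Follow the inner normal from \<open>hit s\<close> into \<open>E\<close>. The cut argument tends to \<open>s\<close> along it by
  \<open>bent_arg_corner\<close>, and so does the label of the front.
\<close>

lemma behind_front: "behind (front s)"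
proof -
  obtain n where n: "n \<noteq> 0" "\<forall>v. n \<bullet> v < 0 \<longrightarrow> (\<exists>\<epsilon>>0. \<forall>t. 0 < t \<and> t < \<epsilon> \<longrightarrow> hit s + of_real t * v \<in> E)"
      "Re (tilt \<sigma> s n) \<le> 0" "Re (tilt \<sigma> s n) * cos \<tau> + Im (tilt \<sigma> s n) * sin \<tau> \<ge> 0"
    by (rule normal_at_turn)
  let ?N = "tilt \<sigma> s n"
  define z where "z t = hit s + of_real t * (- n)" for t :: real
  have "tilt \<sigma> s (hit s) = of_real (hit_dist s)"
    unfolding hit_def using tilt_rcis[OF sgn, of s "hit_dist s" s] by (simp add: rcis_def)
  then have tz: "tilt \<sigma> s (z t) = of_real (hit_dist s) - of_real t * ?N" for t
  proof -
    have "z t = hit s + of_real (- t) * n" by (simp add: z_def)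
    then show ?thesis using \<open>tilt \<sigma> s (hit s) = of_real (hit_dist s)\<close> by (simp only: tilt_add tilt_scale) simp
  qed
  have lim: "((\<lambda>t. bent_arg (hit_dist s) \<tau> (tilt \<sigma> s (z t))) \<longlongrightarrow> 0) (at_right 0)"
    unfolding tz by (rule bent_arg_corner[OF turn_bounds[OF sgn turn] tilt_nonzero[OF sgn n(1)] n(3,4)])
  obtain \<delta> where \<delta>: "\<delta> > 0" "\<And>z. z \<in> E \<Longrightarrow> dist (hit s) z < \<delta> \<Longrightarrow> z \<in> fst (front s) \<and> \<bar>label (front s) z - s\<bar> < 1"
    using label_near_frontier[OF fst_front hit_frontier front_sheet, of 1 s] by auto
  have "n \<bullet> (- n) < 0" using n(1) by simp
  then obtain \<epsilon> where \<epsilon>: "\<epsilon> > 0" "\<And>t. 0 < t \<Longrightarrow> t < \<epsilon> \<Longrightarrow> z t \<in> E"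
    using n(2) unfolding z_def by blast
  have "(z \<longlongrightarrow> hit s + of_real 0 * (- n)) (at_right 0)" unfolding z_def by (intro tendsto_intros)
  then have "\<forall>\<^sub>F t in at_right 0. dist (z t) (hit s) < \<delta>" using tendstoD[OF _ \<delta>(1)] by simp
  moreover have "\<forall>\<^sub>F t in at_right 0. dist (bent_arg (hit_dist s) \<tau> (tilt \<sigma> s (z t))) 0 < 1"
    using tendstoD[OF lim, of 1] by simp
  moreover have "\<forall>\<^sub>F t in at_right 0. 0 < t \<and> t < \<epsilon>"
    using \<epsilon>(1) by (auto simp: eventually_at_right_field)
  ultimately have "\<forall>\<^sub>F t in at_right 0. dist (z t) (hit s) < \<delta> \<and> dist (bent_arg (hit_dist s) \<tau> (tilt \<sigma> s (z t))) 0 < 1 \<and> 0 < t \<and> t < \<epsilon>"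
    by eventually_elim auto
  then obtain t where t: "dist (z t) (hit s) < \<delta>" "dist (bent_arg (hit_dist s) \<tau> (tilt \<sigma> s (z t))) 0 < 1" "0 < t" "t < \<epsilon>"
    using eventually_happens'[OF trivial_limit_at_right_real] by blast
  have zt: "z t \<in> fst (front s)" "\<bar>label (front s) (z t) - s\<bar> < 1"
    using \<delta>(2)[of "z t"] \<epsilon>(2)[of t] t by (auto simp: dist_commute)
  have At: "\<bar>branch \<sigma> s \<tau> (z t) - s\<bar> < 1" using t(2) sgn by (auto simp: branch_def)
  show ?thesis
  proof (rule ccontr)
    assume "\<not> behind (front s)"
    from behind_cases[OF fst_front this zt(1)] show False using zt(2) At sgn pi_gt3 by auto
  qed
qed

lemma behind_bound:
  assumes K: "behind K" and zt: "(z, t) \<in> sheet K" shows "\<sigma> * (t - s) \<le> \<tau>"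
proof -
  obtain w where w: "\<forall>n. w n \<in> fst K" "w \<longlonglongrightarrow> z" "(\<lambda>n. label K (w n)) \<longlonglongrightarrow> t"
    by (rule sheet_limit[OF zt])
  have "\<sigma> * (label K (w n) - s) \<le> \<tau>" for n
    using K w(1) branch_bound(1)[OF sgn turn, of "w n"] piece_subset unfolding behind_def
    by (meson less_imp_le order_trans subsetD)
  moreover have "(\<lambda>n. \<sigma> * (label K (w n) - s)) \<longlonglongrightarrow> \<sigma> * (t - s)" by (intro tendsto_intros w)
  ultimately show ?thesis by (intro LIMSEQ_le_const2[of _ _ \<tau>]) auto
qed

text \<open>
  Let \<open>z\<close> be a point of the sheet \<open>K\<close> at angle \<open>u\<close>. If \<open>K\<close> were on the other side of the cut, then the
  cut argument near \<open>z\<close> would be at most about \<open>u - 2 * pi\<close> (for \<open>\<sigma> = 1\<close>), which is possible only for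
  \<open>u \<ge> s\<close>. But the ray at angle \<open>u\<close> crosses the cut at most once, no later than at
  \<open>hit u\<close>, which is on the far side or on the cut; beyond it the cut argument is \<open>u\<close>.
\<close>

lemma behind_hidden:
  assumes J: "behind (front u)" and K: "fst K \<in> X" "(z, u) \<in> sheet K"
  shows "behind K"
proof (cases "z = hit u")
  case True
  then show ?thesis using front_eqI K J by blast
next
  case False
  define \<delta> where "\<delta> = \<sigma> * (u - s)"
  have z: "z = rcis (cmod z) u" using sheet_polar[OF K] .
  have zR: "hit_dist u < cmod z" using closure_beyond_front[OF sheet_closure(2)[OF K] z False] .
  have tz: "tilt \<sigma> s z = rcis (cmod z) \<delta>" by (subst z) (simp add: tilt_rcis[OF sgn] \<delta>_def)
  have tau: "0 < \<tau>" "\<tau> < pi" "0 < hit_dist s" by (rule turn_bounds[OF sgn turn])+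
  have st: "sin \<tau> > 0" using tau sin_gt_zero by simp
  show ?thesis
  proof (rule ccontr)
    assume n: "\<not> behind K"
    obtain w where w: "\<forall>n. w n \<in> fst K" "w \<longlonglongrightarrow> z" "(\<lambda>n. label K (w n)) \<longlonglongrightarrow> u"
      by (rule sheet_limit[OF K(2)])
    have wE: "w n \<in> E" for n using w(1) piece_subset[OF K(1)] by blast
    have sA: "\<sigma> * (branch \<sigma> s \<tau> x - s) = bent_arg (hit_dist s) \<tau> (tilt \<sigma> s x)" for x using sgn by (auto simp: branch_def)
    have le: "bent_arg (hit_dist s) \<tau> (tilt \<sigma> s (w n)) \<le> \<sigma> * (label K (w n) - s) - 2 * pi" for n
      using behind_cases[OF K(1) n] w(1) sA by simp
    have lim: "(\<lambda>n. \<sigma> * (label K (w n) - s) - 2 * pi) \<longlonglongrightarrow> \<delta> - 2 * pi"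
      unfolding \<delta>_def by (intro tendsto_intros w)
    have "- 2 * pi \<le> \<delta> - 2 * pi"
    proof (rule LIMSEQ_le_const[OF lim], intro exI[of _ 0] allI impI)
      fix n show "- 2 * pi \<le> \<sigma> * (label K (w n) - s) - 2 * pi"
        using le[of n] branch_bound(2)[OF sgn turn wE[of n]] sA[of "w n"] by linarith
    qed
    then have \<delta>0: "0 \<le> \<delta>" by simp
    have right: "side (hit_dist s) \<tau> (rcis (cmod z) \<delta>) < 0 \<and> \<delta> < pi"
    proof (cases "\<delta> = 0")
      case True
      then have "u = s" using sgn by (auto simp: \<delta>_def)
      then have "(hit_dist s - cmod z) * sin \<tau> < 0" using zR st by (simp add: mult_neg_pos)
      moreover have "side (hit_dist s) \<tau> (rcis (cmod z) 0) = (hit_dist s - cmod z) * sin \<tau>"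
        unfolding side_rcis by (simp add: algebra_simps)
      ultimately show ?thesis using True by simp
    next
      case False
      then have \<delta>p: "\<delta> > 0" using \<delta>0 by simp
      obtain x where x: "\<forall>n. x n \<in> fst (front u)" "x \<longlonglongrightarrow> hit u" "(\<lambda>n. label (front u) (x n)) \<longlonglongrightarrow> u"
        by (rule sheet_limit[OF front_sheet])
      have "(\<lambda>n. \<sigma> * (label (front u) (x n) - s)) \<longlonglongrightarrow> \<delta>" unfolding \<delta>_def by (intro tendsto_intros x)
      from order_tendstoD(1)[OF this \<delta>p]
      have ev: "\<forall>\<^sub>F n in sequentially. 0 < \<sigma> * (label (front u) (x n) - s)" .
      have ev': "\<forall>\<^sub>F n in sequentially. side (hit_dist s) \<tau> (tilt \<sigma> s (x n)) \<le> 0"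
        using ev
      proof eventually_elim
        case (elim n)
        then have "0 < bent_arg (hit_dist s) \<tau> (tilt \<sigma> s (x n))" 
        proof -
          have "\<sigma> * (label (front u) (x n) - s) \<le> \<sigma> * (branch \<sigma> s \<tau> (x n) - s)" using J x(1) unfolding behind_def by blast
          then show ?thesis using elim sA[of "x n"] by linarith
        qed
        then show ?case using bent_arg_pos by fastforce
      qed
      have "isCont (\<lambda>x. side (hit_dist s) \<tau> (tilt \<sigma> s x)) (hit u)"
        using continuous_on_compose2[OF continuous_side[of UNIV] continuous_tilt[of UNIV]]
        by (simp add: continuous_on_eq_continuous_at)
      from isCont_tendsto_compose[OF this x(2)]
      have "side (hit_dist s) \<tau> (tilt \<sigma> s (hit u)) \<le> 0" by (rule tendsto_upperbound[OF _ ev']) simp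
      then have sP: "hit_dist u * sin (\<delta> - \<tau>) + hit_dist s * sin \<tau> \<le> 0"
        by (simp add: hit_def tilt_rcis[OF sgn] side_rcis \<delta>_def)
      have "hit_dist s * sin \<tau> > 0" using st tau by simp
      then have "hit_dist u * sin (\<delta> - \<tau>) < 0" using sP by linarith
      then have sn: "sin (\<delta> - \<tau>) < 0" using hit_dist_pos[of u] by (simp add: mult_less_0_iff)
      have "\<delta> \<le> \<tau>" using behind_bound[OF J front_sheet] by (simp add: \<delta>_def)
      moreover have "cmod z * sin (\<delta> - \<tau>) < hit_dist u * sin (\<delta> - \<tau>)" using sn zR by (simp add: mult_less_cancel_right)
      ultimately show ?thesis using sP tau by (simp add: side_rcis)
    qed
    have z0: "0 < cmod z" using zR hit_dist_pos[of u] by linarith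
    have noc: "\<not> on_cut (hit_dist s) \<tau> (tilt \<sigma> s z)"
    proof
      assume "on_cut (hit_dist s) \<tau> (tilt \<sigma> s z)"
      then have re: "Im (tilt \<sigma> s z) = 0" "Re (tilt \<sigma> s z) \<le> hit_dist s"
        using right unfolding on_cut_def tz by auto
      then show False using side_neg_real[OF tau, of "tilt \<sigma> s z"] right tz by simp
    qed
    have "(\<lambda>n. bent_arg (hit_dist s) \<tau> (tilt \<sigma> s (w n))) \<longlonglongrightarrow> bent_arg (hit_dist s) \<tau> (tilt \<sigma> s z)"
      using isCont_tendsto_compose[OF isCont_tilted[OF sgn turn noc] w(2)] .
    moreover have "bent_arg (hit_dist s) \<tau> (tilt \<sigma> s z) = \<delta>"
      unfolding tz using bent_arg_beyond[OF \<delta>0 _ z0] right by blast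
    ultimately have "\<delta> \<le> \<delta> - 2 * pi"
      using LIMSEQ_le[OF _ lim] le by auto
    then show False using pi_gt_zero by linarith
  qed
qed

end

section \<open>Tangency where the front changes\<close>

text \<open>
  The points \<open>hit (s + \<sigma> * u)\<close> with front \<open>K\<close> accumulate at a point \<open>q\<close> beyond \<open>hit s\<close> on the same
  ray. A free ray on the other side would leave room for a direction \<open>v\<close> into \<open>E\<close> that points to the
  side \<open>\<sigma>\<close>; the points of \<open>E\<close> near \<open>hit s\<close> in this direction would block the sight of the points near
  \<open>q\<close>.
\<close>

lemma tangent_at_edge:
  assumes sgn: "\<sigma> \<in> {1, - 1}" and K: "K \<noteq> front s"
    and ev: "\<And>\<epsilon>. \<epsilon> > 0 \<Longrightarrow> \<exists>u. 0 < u \<and> u < \<epsilon> \<and> front (s + \<sigma> * u) = K"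
  shows "\<not> turn (- \<sigma>) s \<tau>"
proof
  assume turn: "turn (- \<sigma>) s \<tau>"
  have sgn': "- \<sigma> \<in> {1, - 1}" using sgn by auto
  have st: "sin \<tau> > 0" using turn sin_gt_zero by (simp add: turn_def)
  obtain d where d: "\<And>n. 0 < d n \<and> d n < 1 / real (Suc n) \<and> front (s + \<sigma> * d n) = K"
    using ev[of "1 / real (Suc _)"] by (metis divide_pos_pos of_nat_0_less_iff zero_less_Suc zero_less_one)
  have d0: "d \<longlonglongrightarrow> 0"
    using d by (intro tendsto_sandwich[OF _ _ tendsto_const LIMSEQ_inverse_real_of_nat]) (auto simp: inverse_eq_divide less_imp_le)
  have fK: "fst K \<in> X" using d[of 0] fst_front by metis
  have PK: "(hit (s + \<sigma> * d n), s + \<sigma> * d n) \<in> sheet K" for n using front_sheet[of "s + \<sigma> * d n"] d by simp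
  obtain q f where f: "strict_mono f" "((\<lambda>n. hit (s + \<sigma> * d n)) \<circ> f) \<longlonglongrightarrow> q"
  proof -
    have "compact (closure E)" using bounded_E by (simp add: compact_closure)
    then have "\<exists>l\<in>closure E. \<exists>r. strict_mono r \<and> ((\<lambda>n. hit (s + \<sigma> * d n)) \<circ> r) \<longlonglongrightarrow> l"
      using hit_closure unfolding compact_def by (metis (no_types, lifting))
    then show thesis using that by blast
  qed
  have df: "(\<lambda>n. d (f n)) \<longlonglongrightarrow> 0" using LIMSEQ_subseq_LIMSEQ[OF d0 f(1)] by (simp add: o_def)
  have Pf: "(\<lambda>n. hit (s + \<sigma> * d (f n))) \<longlonglongrightarrow> q" using f(2) by (simp add: o_def)
  have "(\<lambda>n. s + \<sigma> * d (f n)) \<longlonglongrightarrow> s + \<sigma> * 0" by (intro tendsto_intros df)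
  then have sf: "(\<lambda>n. s + \<sigma> * d (f n)) \<longlonglongrightarrow> s" by simp
  have "closed (sheet K)" by (simp add: sheet_def)
  from closed_sequentially[OF this _ tendsto_Pair[OF Pf sf]] have q: "(q, s) \<in> sheet K" using PK by blast
  have "q \<noteq> hit s" using front_eqI[OF fK, of s] q K by auto
  then have qR: "hit_dist s < cmod q"
    using closure_beyond_front[OF sheet_closure(2)[OF fK q] sheet_polar[OF fK q]] by blast
  have Rf: "(\<lambda>n. hit_dist (s + \<sigma> * d (f n))) \<longlonglongrightarrow> cmod q" using tendsto_norm[OF Pf] by (simp add: norm_hit)
  obtain n where n: "n \<noteq> 0" "\<forall>v. n \<bullet> v < 0 \<longrightarrow> (\<exists>\<epsilon>>0. \<forall>t. 0 < t \<and> t < \<epsilon> \<longrightarrow> hit s + of_real t * v \<in> E)"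
      "Re (tilt (- \<sigma>) s n) \<le> 0" "Re (tilt (- \<sigma>) s n) * cos \<tau> + Im (tilt (- \<sigma>) s n) * sin \<tau> \<ge> 0"
    by (rule normal_at_turn[OF sgn' turn])
  let ?N = "tilt (- \<sigma>) s n"
  have N0: "?N \<noteq> 0" by (rule tilt_nonzero[OF sgn' n(1)])
  obtain c where c: "Re ?N * c - Im ?N < 0"
  proof (cases "Re ?N = 0")
    case True
    then have "Im ?N \<noteq> 0" "Im ?N * sin \<tau> \<ge> 0" using N0 n(4) by (auto simp: complex_eq_iff)
    then have "Im ?N > 0" using st by (auto simp: zero_le_mult_iff)
    then show thesis using that[of 0] True by simp
  next
    case False
    then have "Re ?N < 0" using n(3) by simp
    then have "Re ?N * ((1 + \<bar>Im ?N\<bar>) / (- Re ?N)) = - (1 + \<bar>Im ?N\<bar>)" by simp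
    then have "Re ?N * ((1 + \<bar>Im ?N\<bar>) / (- Re ?N)) - Im ?N < 0" by linarith
    then show thesis by (rule that)
  qed
  define v where "v = cis s * Complex c \<sigma>"
  have tv: "tilt (- \<sigma>) s v = Complex c (- 1)"
  proof -
    have "v * cis (- s) = Complex c \<sigma>" by (simp add: v_def mult.commute mult.left_commute cis_mult)
    then show ?thesis using sgn by (auto simp: tilt_def)
  qed
  have "n \<bullet> v = ?N \<bullet> tilt (- \<sigma>) s v" by (simp add: tilt_inner[OF sgn'])
  also have "\<dots> < 0" using c by (simp add: tv inner_complex_def)
  finally obtain \<epsilon> where \<epsilon>: "\<epsilon> > 0" "\<And>t. 0 < t \<Longrightarrow> t < \<epsilon> \<Longrightarrow> hit s + of_real t * v \<in> E" using n(2) by metis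
  \<comment> \<open>The line from \<open>hit s\<close> in the direction \<open>v\<close> meets the ray at angle \<open>s + \<sigma> * x\<close> at distance
    \<open>hit_dist s / g x\<close> from the origin and with parameter \<open>hit_dist s * sin x / g x\<close>.\<close>
  define g where "g x = cos x - c * sin x" for x
  have "(\<lambda>n. g (d (f n))) \<longlonglongrightarrow> cos 0 - c * sin 0" unfolding g_def by (intro tendsto_intros df)
  then have g: "(\<lambda>n. g (d (f n))) \<longlonglongrightarrow> 1" by simp
  have "(\<lambda>n. hit_dist s / g (d (f n))) \<longlonglongrightarrow> hit_dist s / 1" by (intro tendsto_intros g) simp
  then have \<rho>: "(\<lambda>n. hit_dist s / g (d (f n))) \<longlonglongrightarrow> hit_dist s" by simp
  have "(\<lambda>n. hit_dist s * sin (d (f n)) / g (d (f n))) \<longlonglongrightarrow> hit_dist s * sin 0 / 1" by (intro tendsto_intros g df) simp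
  then have tt: "(\<lambda>n. hit_dist s * sin (d (f n)) / g (d (f n))) \<longlonglongrightarrow> 0" by simp
  have "\<forall>\<^sub>F n in sequentially. hit_dist s / g (d (f n)) < (hit_dist s + cmod q) / 2"
    using qR by (intro order_tendstoD(2)[OF \<rho>]) simp
  moreover have "\<forall>\<^sub>F n in sequentially. (hit_dist s + cmod q) / 2 < hit_dist (s + \<sigma> * d (f n))"
    using qR by (intro order_tendstoD(1)[OF Rf]) simp
  moreover have "\<forall>\<^sub>F n in sequentially. hit_dist s * sin (d (f n)) / g (d (f n)) < \<epsilon>"
    by (rule order_tendstoD(2)[OF tt \<epsilon>(1)])
  moreover have "\<forall>\<^sub>F n in sequentially. 0 < g (d (f n))" by (rule order_tendstoD(1)[OF g]) simp
  moreover have "\<forall>\<^sub>F n in sequentially. d (f n) < pi" by (rule order_tendstoD(2)[OF df]) simp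
  ultimately have "\<forall>\<^sub>F n in sequentially. hit_dist s / g (d (f n)) < hit_dist (s + \<sigma> * d (f n)) \<and>
      hit_dist s * sin (d (f n)) / g (d (f n)) < \<epsilon> \<and> 0 < g (d (f n)) \<and> d (f n) < pi"
    by eventually_elim (intro conjI; linarith)
  then obtain k where k: "hit_dist s / g (d (f k)) < hit_dist (s + \<sigma> * d (f k))"
      "hit_dist s * sin (d (f k)) / g (d (f k)) < \<epsilon>" "0 < g (d (f k))" "d (f k) < pi"
    using eventually_happens'[OF sequentially_bot] by blast
  define x where "x = d (f k)"
  define t where "t = hit_dist s * sin x / g x"
  define r where "r = hit_dist s / g x"
  have x: "0 < x" "x < pi" "0 < g x" using d[of "f k"] k by (auto simp: x_def)
  have sx: "sin x > 0" using x sin_gt_zero by simp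
  have t: "0 < t" "t < \<epsilon>" using k sx x hit_dist_pos[of s] by (auto simp: t_def x_def)
  have r: "0 < r" "r < hit_dist (s + \<sigma> * x)" using k x hit_dist_pos[of s] by (auto simp: r_def x_def)
  have e1: "r * sin x = t" by (simp add: r_def t_def)
  have e2: "r * cos x = hit_dist s + t * c"
  proof -
    have "r * (cos x - c * sin x) = hit_dist s" using x by (simp add: r_def g_def)
    then show ?thesis using e1 by (simp add: algebra_simps)
  qed
  have "hit s + of_real t * v = cis s * Complex (hit_dist s + t * c) (\<sigma> * t)"
    by (simp add: v_def hit_def complex_eq_iff algebra_simps)
  also have "\<dots> = cis s * Complex (r * cos x) (\<sigma> * (r * sin x))" by (simp add: e1 e2)
  also have "\<dots> = rcis r (s + \<sigma> * x)"
    using sgn by (auto simp: complex_eq_iff cos_add sin_add cos_diff sin_diff algebra_simps)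
  finally have "rcis r (s + \<sigma> * x) \<in> E" using \<epsilon>(2)[OF t] by simp
  then show False using before_front[of r "s + \<sigma> * x"] r by simp
qed

section \<open>A dark point yields a layered view\<close>

lemma turn_leans:
  assumes sgn: "\<sigma> \<in> {1, - 1}" and turn: "turn \<sigma> s \<tau>"
  shows "leans cov front \<sigma> s"
  unfolding leans_def
proof (intro allI impI)
  fix K t assume r: "(hides cov front)\<^sup>*\<^sup>* (front s) K" and t: "t \<in> cov K"
  have "behind \<sigma> s \<tau> K"
    using r
  proof induction
    case base
    show ?case by (rule behind_front[OF sgn turn])
  next
    case (step J K)
    obtain u where u: "front u = J" "u \<in> cov K" using step.hyps(2) unfolding hides_def by blast
    then obtain z where "fst K \<in> X" "(z, u) \<in> sheet K" unfolding cov_def by (auto split: if_splits)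
    then show ?case using behind_hidden[OF sgn turn] step.IH u(1) by blast
  qed
  moreover obtain z where "(z, t) \<in> sheet K" using t unfolding cov_def by (auto split: if_splits)
  ultimately have "\<sigma> * (t - s) \<le> \<tau>" by (rule behind_bound[OF sgn turn])
  then show "\<sigma> * (t - s) < pi" using turn unfolding turn_def by linarith
qed

sublocale views: layered_views X cov front
proof
  show "finite X" by (rule finite_X)
  show "cov (x, k) \<noteq> {} \<longleftrightarrow> x \<in> X" for x k
    using nonempty_piece[of x] by (auto simp: cov_def sheet_def)
  show "t + 2 * pi * of_int m \<in> cov (x, k + m) \<longleftrightarrow> t \<in> cov (x, k)" for t m x k
    using sheet_shift[of _ t m x k] by (force simp: cov_def image_iff)
  show "connected (cov K)" for K
    unfolding cov_def using connected_sheet[of K]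
    by (auto intro!: connected_continuous_image continuous_on_snd continuous_on_id)
  show "compact (cov K)" for K
    unfolding cov_def using compact_sheet[of K]
    by (auto intro!: compact_continuous_image continuous_on_snd continuous_on_id)
  show "front (s + 2 * pi * of_int m) = (fst (front s), snd (front s) + m)" for s m by (rule front_shift)
  show "s \<in> cov (front s)" for s
    using front_sheet[of s] fst_front[of s] by (force simp: cov_def)
  show "leans cov front 1 s \<or> leans cov front (- 1) s" for s
  proof -
    obtain \<sigma> \<tau> where st: "\<sigma> \<in> {1, - 1}" "turn \<sigma> s \<tau>" by (rule turn_cases)
    then show ?thesis using turn_leans[OF st] by auto
  qed
  show "leans cov front \<sigma> s" if "\<sigma> \<in> {1, - 1}" "K \<noteq> front s"
      "\<And>\<epsilon>. \<epsilon> > 0 \<Longrightarrow> \<exists>u. 0 < u \<and> u < \<epsilon> \<and> front (s + \<sigma> * u) = K" for \<sigma> K s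
  proof -
    obtain \<sigma>' \<tau> where st: "\<sigma>' \<in> {1, - 1}" "turn \<sigma>' s \<tau>" by (rule turn_cases)
    have "\<sigma>' \<noteq> - \<sigma>" using tangent_at_edge[OF that] st(2) by blast
    then have "\<sigma>' = \<sigma>" using st(1) that(1) by auto
    then show ?thesis using turn_leans[OF st] by simp
  qed
qed

end

section \<open>Sublevel sets near a regular boundary point\<close>

lemma sublevel_inner_cone:
  fixes \<phi> :: "'a::euclidean_space \<Rightarrow> real"
  assumes p: "p \<in> frontier E" and U: "open U" "p \<in> U"
    and d: "(\<phi> has_derivative (\<lambda>h. n \<bullet> h)) (at p)"
    and EU: "E \<inter> U = {x \<in> U. \<phi> x < 0}" and v: "n \<bullet> v < 0"
  shows "\<exists>\<epsilon>>0. \<forall>t. 0 < t \<and> t < \<epsilon> \<longrightarrow> p + t *\<^sub>R v \<in> E"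
proof -
  have cont: "isCont \<phi> p" using d has_derivative_continuous by blast
  have "p \<in> closure E" using p by (simp add: frontier_def)
  then obtain w where w: "\<And>n. w n \<in> E" "w \<longlonglongrightarrow> p" unfolding closure_sequential by blast
  have "\<forall>\<^sub>F n in sequentially. w n \<in> U" using topological_tendstoD[OF w(2) U] .
  then have "\<forall>\<^sub>F n in sequentially. \<phi> (w n) \<le> 0"
  proof eventually_elim
    case (elim n)
    then have "w n \<in> E \<inter> U" using w(1) by blast
    then show ?case unfolding EU by simp
  qed
  then have p0: "\<phi> p \<le> 0"
    using tendsto_upperbound[OF isCont_tendsto_compose[OF cont w(2)]] by simp
  have "(\<phi> has_derivative (\<lambda>h. n \<bullet> h)) (at (p + 0 *\<^sub>R v))" using d by simp
  moreover have "((\<lambda>t. p + t *\<^sub>R v) has_derivative (\<lambda>t. t *\<^sub>R v)) (at 0)"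
    by (auto intro!: derivative_eq_intros)
  ultimately have "((\<lambda>t. \<phi> (p + t *\<^sub>R v)) has_derivative (\<lambda>t. n \<bullet> (t *\<^sub>R v))) (at 0)"
    by (rule has_derivative_compose[rotated, where f = "\<lambda>t. p + t *\<^sub>R v"])
  then have "((\<lambda>t. \<phi> (p + t *\<^sub>R v)) has_field_derivative (n \<bullet> v)) (at 0)"
    unfolding has_field_derivative_def by (rule has_derivative_eq_rhs) (simp add: fun_eq_iff)
  from DERIV_neg_dec_right[OF this v] obtain e
    where e: "e > 0" "\<And>t. 0 < t \<Longrightarrow> t < e \<Longrightarrow> \<phi> (p + t *\<^sub>R v) < \<phi> p" by auto
  have "((\<lambda>t. p + t *\<^sub>R v) \<longlongrightarrow> p + 0 *\<^sub>R v) (at_right 0)" by (intro tendsto_intros)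
  then have "\<forall>\<^sub>F t in at_right 0. p + t *\<^sub>R v \<in> U" using topological_tendstoD U by fastforce
  then obtain e' where e': "e' > 0" "\<And>t. 0 < t \<Longrightarrow> t < e' \<Longrightarrow> p + t *\<^sub>R v \<in> U"
    unfolding eventually_at_right_field by blast
  have "p + t *\<^sub>R v \<in> E" if "0 < t" "t < min e e'" for t
  proof -
    have "p + t *\<^sub>R v \<in> {x \<in> U. \<phi> x < 0}" using e(2)[of t] e'(2)[of t] p0 that by auto
    then show ?thesis unfolding EU[symmetric] by simp
  qed
  then show ?thesis using e(1) e'(1) by (intro exI[of _ "min e e'"]) auto
qed

text \<open>
  Flowing against the normal at \<open>p\<close> decreases \<open>\<phi>\<close>, so all points of \<open>E\<close> close to \<open>p\<close> are joined inside
  \<open>E\<close> by parallel segments to one small ball around the point \<open>c\<close> on the inner normal.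
\<close>

lemma sublevel_one_sided:
  fixes \<phi> :: "'a::euclidean_space \<Rightarrow> real"
  assumes E: "open E" and p: "p \<in> frontier E" and U: "open U" "p \<in> U"
    and d: "\<And>x. x \<in> U \<Longrightarrow> (\<phi> has_derivative (\<lambda>h. g x \<bullet> h)) (at x)"
    and g: "continuous_on U g" "g p \<noteq> 0"
    and EU: "E \<inter> U = {x \<in> U. \<phi> x < 0}" and \<epsilon>: "\<epsilon> > 0"
  shows "\<exists>\<delta>>0. \<exists>Q. connected Q \<and> E \<inter> ball p \<delta> \<subseteq> Q \<and> Q \<subseteq> E \<inter> ball p \<epsilon>"
proof -
  let ?n = "g p"
  have "isCont g p" using g(1) U(2) by (simp add: continuous_on_eq_continuous_at[OF U(1)])
  then have "isCont (\<lambda>x. g x \<bullet> ?n) p" by (rule continuous_inner[OF _ continuous_const])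
  then have lim: "((\<lambda>x. g x \<bullet> ?n) \<longlongrightarrow> g p \<bullet> ?n) (nhds p)"
    using tendsto_at_iff_tendsto_nhds[of "\<lambda>x. g x \<bullet> ?n" p] by (simp add: isCont_def)
  have "\<forall>\<^sub>F x in nhds p. 0 < g x \<bullet> ?n" using g(2) by (intro order_tendstoD(1)[OF lim]) simp
  then have "\<forall>\<^sub>F x in nhds p. 0 < g x \<bullet> ?n \<and> x \<in> U"
    using eventually_nhds_in_open[OF U] by (rule eventually_conj)
  then obtain r0 where r0: "r0 > 0" "\<And>x. dist x p < r0 \<Longrightarrow> 0 < g x \<bullet> ?n \<and> x \<in> U"
    unfolding eventually_nhds_metric by metis
  define r where "r = min r0 \<epsilon>"
  have r: "r > 0" "r \<le> \<epsilon>" "\<And>x. x \<in> ball p r \<Longrightarrow> 0 < g x \<bullet> ?n \<and> x \<in> U"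
    using r0 \<epsilon> by (simp_all add: r_def dist_commute)
  have "?n \<bullet> (- ?n) < 0" using g(2) by simp
  from sublevel_inner_cone[OF p U d[OF U(2)] EU this]
  obtain e where e: "e > 0" "\<And>t. 0 < t \<Longrightarrow> t < e \<Longrightarrow> p + t *\<^sub>R (- ?n) \<in> E" by blast
  define a where "a = min (e / 2) (r / (4 * norm ?n))"
  have a: "0 < a" "a < e" using e r g(2) by (auto simp: a_def)
  have "a * norm ?n \<le> r / (4 * norm ?n) * norm ?n" by (intro mult_right_mono) (auto simp: a_def)
  also have "\<dots> = r / 4" using g(2) by simp
  finally have an: "a * norm ?n < r / 2" using r by linarith
  \<comment> \<open>The step \<open>a\<close> keeps the segments within \<open>r\<close> of \<open>p\<close>: they start within \<open>r / 2\<close> and are shorter than \<open>r / 2\<close>.\<close>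
  define c where "c = p - a *\<^sub>R ?n"
  have "c \<in> E" using e(2)[OF a] by (simp add: c_def)
  moreover have "c \<in> ball p r" using an a r by (simp add: c_def dist_norm)
  ultimately have "c \<in> E \<inter> ball p r" by blast
  then obtain \<eta> where \<eta>: "\<eta> > 0" "ball c \<eta> \<subseteq> E \<inter> ball p r"
    using E open_contains_ball[of "E \<inter> ball p r"] by blast
  define \<delta> where "\<delta> = min \<eta> (r / 2)"
  have \<delta>: "0 < \<delta>" "\<delta> \<le> \<eta>" "\<delta> \<le> r / 2" using \<eta> r by (auto simp: \<delta>_def)
  define S where "S z = closed_segment z (z - a *\<^sub>R ?n)" for z
  have seg: "S z \<subseteq> E \<inter> ball p r" if z: "z \<in> E \<inter> ball p \<delta>" for z
  proof
    fix y assume "y \<in> S z"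
    then obtain u where u: "0 \<le> u" "u \<le> 1" "y = z - (u * a) *\<^sub>R ?n"
      unfolding S_def closed_segment_def by (auto simp: algebra_simps)
    have inb: "z - (t * a) *\<^sub>R ?n \<in> ball p r" if t: "0 \<le> t" "t \<le> 1" for t
    proof -
      have "dist p (z - (t * a) *\<^sub>R ?n) \<le> dist p z + norm ((t * a) *\<^sub>R ?n)"
        by (metis dist_norm dist_triangle2 dist_commute diff_diff_eq2 add_diff_cancel_left')
      also have "norm ((t * a) *\<^sub>R ?n) \<le> a * norm ?n"
        using t a by (simp add: mult_left_le_one_le mult_right_mono)
      finally show ?thesis using an z \<delta> by simp
    qed
    have dd: "((\<lambda>t. \<phi> (z - (t * a) *\<^sub>R ?n)) has_field_derivative (- a * (g (z - (t * a) *\<^sub>R ?n) \<bullet> ?n))) (at t)"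
      if t: "0 \<le> t" "t \<le> 1" for t
    proof -
      have "((\<lambda>t. z - (t * a) *\<^sub>R ?n) has_derivative (\<lambda>t. - ((t * a) *\<^sub>R ?n))) (at t)"
        by (auto intro!: derivative_eq_intros)
      from has_derivative_compose[OF this d[of "z - (t * a) *\<^sub>R ?n"]]
      have "((\<lambda>t. \<phi> (z - (t * a) *\<^sub>R ?n)) has_derivative (\<lambda>s. g (z - (t * a) *\<^sub>R ?n) \<bullet> - ((s * a) *\<^sub>R ?n))) (at t)"
        using r(3)[OF inb[OF t]] by simp
      then show ?thesis unfolding has_field_derivative_def
        by (rule has_derivative_eq_rhs) (simp add: fun_eq_iff algebra_simps)
    qed
    have "\<phi> (z - (u * a) *\<^sub>R ?n) \<le> \<phi> (z - (0 * a) *\<^sub>R ?n)"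
    proof (rule DERIV_nonpos_imp_nonincreasing[OF u(1)])
      fix t assume t: "0 \<le> t" "t \<le> u"
      then have t1: "t \<le> 1" using u by linarith
      have "- a * (g (z - (t * a) *\<^sub>R ?n) \<bullet> ?n) \<le> 0"
        using r(3)[OF inb[OF t(1) t1]] a by simp
      then show "\<exists>y. ((\<lambda>t. \<phi> (z - (t * a) *\<^sub>R ?n)) has_real_derivative y) (at t) \<and> y \<le> 0"
        using dd[OF t(1) t1] by blast
    qed
    moreover have "z \<in> {x \<in> U. \<phi> x < 0}" unfolding EU[symmetric] using z r(3)[of z] \<delta> r(1) by auto
    ultimately have "\<phi> y < 0" using u by simp
    moreover have yr: "y \<in> ball p r" using inb u by blast
    ultimately have "y \<in> {x \<in> U. \<phi> x < 0}" using r(3) by blast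
    then show "y \<in> E \<inter> ball p r" unfolding EU[symmetric] using yr by blast
  qed
  define Q where "Q = ball c \<eta> \<union> (\<Union>z\<in>E \<inter> ball p \<delta>. S z \<union> ball c \<eta>)"
  have meet: "z - a *\<^sub>R ?n \<in> S z \<inter> ball c \<eta>" if "z \<in> E \<inter> ball p \<delta>" for z
  proof -
    have "dist c (z - a *\<^sub>R ?n) = dist p z" by (simp add: c_def dist_norm)
    then show ?thesis using that \<delta> by (auto simp: S_def)
  qed
  have "connected Q"
  proof -
    have "connected (S z \<union> ball c \<eta>)" if "z \<in> E \<inter> ball p \<delta>" for z
      using meet[OF that] by (intro connected_Un) (auto simp: S_def)
    then have "connected (\<Union>(insert (ball c \<eta>) ((\<lambda>z. S z \<union> ball c \<eta>) ` (E \<inter> ball p \<delta>))))"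
      using \<eta>(1) by (intro connected_Union) (auto intro!: exI[of _ c])
    then show ?thesis by (simp add: Q_def)
  qed
  moreover have "E \<inter> ball p \<delta> \<subseteq> Q" by (auto simp: Q_def S_def)
  moreover have "Q \<subseteq> E \<inter> ball p r" unfolding Q_def using seg \<eta>(2) by blast
  then have "Q \<subseteq> E \<inter> ball p \<epsilon>" using subset_ball[OF r(2), of p] by blast
  ultimately show ?thesis using \<delta>(1) by blast
qed

section \<open>From the real plane to the complex plane\<close>

definition plane :: "complex \<Rightarrow> real^2" where
  "plane z = vector [Re z, Im z]"

lemma plane_nth [simp]: "plane z $ 1 = Re z" "plane z $ 2 = Im z"
  by (simp_all add: plane_def)

lemma plane_inner: "plane a \<bullet> plane b = a \<bullet> b"
  by (simp add: inner_vec_def sum_2 inner_complex_def)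

lemma plane_add: "plane (a + b) = plane a + plane b"
  by (simp add: vec_eq_iff forall_2)

lemma plane_diff: "plane (a - b) = plane a - plane b"
  by (simp add: vec_eq_iff forall_2)

lemma plane_scale: "plane (of_real t * a) = t *\<^sub>R plane a"
  by (simp add: vec_eq_iff forall_2)

lemma plane_surj: "\<exists>z. plane z = v"
  by (rule exI[of _ "Complex (v $ 1) (v $ 2)"]) (simp add: vec_eq_iff forall_2)

lemma norm_plane: "norm (plane z) = cmod z"
  by (simp add: norm_eq_sqrt_inner plane_inner)

locale plane_dark_point =
  fixes E :: "(real^2) set" and x :: "real^2"
  assumes open_E: "open E" and bounded_E: "bounded E" and smooth: "smooth_boundary E"
    and weak: "weakly_semiconvex E" and x: "x \<notin> E" "\<not> semiconvex_at E x"
    and fin: "finite (components E)"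
begin

text \<open>An isometry that takes the origin to the dark point.\<close>

definition chart :: "complex \<Rightarrow> real^2" where "chart z = x + plane z"

lemma dist_chart: "dist (chart a) (chart b) = dist a b"
  by (simp add: chart_def dist_norm norm_plane flip: plane_diff)

lemma chart_surj: "\<exists>z. chart z = v"
  using plane_surj[of "v - x"] by (auto simp: chart_def algebra_simps)

lemma inj_chart: "chart a = chart b \<Longrightarrow> a = b"
  using dist_chart[of a b] by simp

lemma continuous_chart: "continuous_on S chart"
  unfolding continuous_on_iff dist_chart by auto

lemma chart_ray: "chart (p + rcis t a) = chart p + t *\<^sub>R plane (cis a)"
  by (simp add: chart_def plane_add rcis_def plane_scale)

lemma connected_chart: assumes "connected D" shows "connected (chart -` D)"
proof -
  define h where "h v = (SOME z. chart z = v)" for v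
  have h: "chart (h v) = v" for v unfolding h_def using someI_ex[OF chart_surj] .
  have "dist (h a) (h b) = dist a b" for a b using dist_chart[of "h a" "h b"] h by simp
  then have "continuous_on D h" unfolding continuous_on_iff by auto
  moreover have "chart -` D = h ` D"
  proof
    show "chart -` D \<subseteq> h ` D"
    proof
      fix z assume "z \<in> chart -` D"
      moreover have "h (chart z) = z" by (rule inj_chart) (rule h)
      ultimately show "z \<in> h ` D" by (metis imageI vimageD)
    qed
    show "h ` D \<subseteq> chart -` D" using h by auto
  qed
  ultimately show ?thesis using connected_continuous_image assms by metis
qed

lemma open_chart: "open S \<Longrightarrow> open (chart -` S)"
  using continuous_chart by (simp add: open_vimage)

lemma closure_chart: "z \<in> closure (chart -` S) \<longleftrightarrow> chart z \<in> closure S"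
  unfolding closure_approachable using chart_surj by (metis dist_chart vimage_eq)

lemma frontier_chart: "z \<in> frontier (chart -` E) \<longleftrightarrow> chart z \<in> frontier E"
  by (simp add: frontier_def interior_open open_E open_chart closure_chart)

lemma x_closure: "x \<notin> closure E"
proof
  assume "x \<in> closure E"
  then have "x \<in> frontier E" using x(1) open_E by (simp add: frontier_def interior_open)
  then show False using weak x(2) by (simp add: weakly_semiconvex_def)
qed

sublocale dark_origin "chart -` E" "(\<lambda>D. chart -` D) ` components E"
proof
  show "chart -` E = \<Union> ((\<lambda>D. chart -` D) ` components E)"
    using Union_components[of E] by blast
  show "finite ((\<lambda>D. chart -` D) ` components E)" using fin by simp
  show "bounded (chart -` E)"
  proof -
    obtain B where B: "\<And>v. v \<in> E \<Longrightarrow> norm v \<le> B" using bounded_E unfolding bounded_iff by blast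
    have "cmod z \<le> B + norm x" if "z \<in> chart -` E" for z
    proof -
      have "cmod z = norm (chart z - x)" by (simp add: chart_def norm_plane)
      also have "\<dots> \<le> norm (chart z) + norm x" by (rule norm_triangle_ineq4)
      finally show ?thesis using B[of "chart z"] that by simp
    qed
    then show ?thesis unfolding bounded_iff by blast
  qed
  have c0: "chart 0 = x" by (simp add: chart_def vec_eq_iff forall_2)
  show "0 \<notin> closure (chart -` E)" using x_closure by (simp add: closure_chart c0)
  fix D assume D: "D \<in> (\<lambda>D. chart -` D) ` components E"
  then obtain C where C: "C \<in> components E" "D = chart -` C" by blast
  show "open D" using C open_components[OF open_E] open_chart by blast
  show "connected D" using C connected_chart in_components_connected by blast
  show "D \<noteq> {}"
  proof -
    obtain v where "v \<in> C" using in_components_nonempty C(1) by blast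
    moreover obtain z where "chart z = v" using chart_surj by blast
    ultimately show ?thesis using C(2) by auto
  qed
  fix D' assume "D' \<in> (\<lambda>D. chart -` D) ` components E" "D \<noteq> D'"
  then obtain C' where C': "C' \<in> components E" "D' = chart -` C'" by blast
  then have "C \<inter> C' = {}"
    using pairwiseD[OF pairwise_disjoint_components C(1) C'(1)] C \<open>D \<noteq> D'\<close> by blast
  then show "D \<inter> D' = {}" using C C' by blast
next
  fix \<theta>
  show "\<exists>t\<ge>0. rcis t \<theta> \<in> chart -` E"
  proof (rule ccontr)
    assume n: "\<not> ?thesis"
    define L where "L = {x + t *\<^sub>R plane (cis \<theta>) | t. 0 \<le> t}"
    have "norm (plane (cis \<theta>)) \<noteq> 0" by (simp add: norm_plane)
    then have "plane (cis \<theta>) \<noteq> 0" by auto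
    then have "is_ray L" unfolding is_ray_def L_def by blast
    moreover have "x \<in> L" unfolding L_def by (rule CollectI, rule exI[of _ 0]) simp
    moreover have "L \<inter> E = {}"
      using n by (auto simp: L_def chart_def rcis_def plane_scale)
    ultimately show False using x(2) unfolding semiconvex_at_def by blast
  qed
next
  fix p assume p: "p \<in> frontier (chart -` E)"
  then have cp: "chart p \<in> frontier E" by (simp add: frontier_chart)
  show "\<exists>a. \<forall>t\<ge>0. p + rcis t a \<notin> chart -` E"
  proof -
    obtain L where L: "is_ray L" "chart p \<in> L" "L \<inter> E = {}"
      using cp weak unfolding weakly_semiconvex_def semiconvex_at_def by blast
    obtain b v where bv: "v \<noteq> 0" "L = {b + t *\<^sub>R v | t. 0 \<le> t}" using L(1) unfolding is_ray_def by blast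
    obtain t0 where t0: "t0 \<ge> 0" "chart p = b + t0 *\<^sub>R v" using L(2) bv(2) by blast
    obtain w where w: "plane w = v" using plane_surj by blast
    have w0: "cmod w > 0" using bv(1) w norm_plane[of w] by auto
    have wa: "w = of_real (cmod w) * cis (Arg w)" using rcis_cmod_Arg[of w] by (simp add: rcis_def)
    have "p + rcis t (Arg w) \<notin> chart -` E" if "t \<ge> 0" for t
    proof -
      have "v = cmod w *\<^sub>R plane (cis (Arg w))" using w wa plane_scale by metis
      then have "plane (cis (Arg w)) = (1 / cmod w) *\<^sub>R v" using w0 by simp
      then have "chart (p + rcis t (Arg w)) = b + (t0 + t / cmod w) *\<^sub>R v"
        by (simp add: chart_ray t0(2) algebra_simps)
      then have "chart (p + rcis t (Arg w)) \<in> L" using bv(2) t0(1) that w0 by auto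
      then show ?thesis using L(3) by auto
    qed
    then show ?thesis by blast
  qed
  from bspec[OF smooth[unfolded smooth_boundary_def] cp]
  obtain U \<phi> and g :: "real^2 \<Rightarrow> real^2" where local_eq: "open U \<and> chart p \<in> U \<and>
      (\<forall>y\<in>U. (\<phi> has_derivative (\<lambda>h. g y \<bullet> h)) (at y)) \<and>
      continuous_on U g \<and> (\<forall>y\<in>U. g y \<noteq> 0) \<and> E \<inter> U = {y \<in> U. \<phi> y < 0}"
    by (elim exE)
  then have U: "open U" "chart p \<in> U" and g: "continuous_on U g"
    and EU: "E \<inter> U = {y \<in> U. \<phi> y < 0}" by simp_all
  have d: "(\<phi> has_derivative (\<lambda>h. g y \<bullet> h)) (at y)" if "y \<in> U" for y using local_eq that by simp
  have g0: "g (chart p) \<noteq> 0" using local_eq by simp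
  show "\<exists>n. n \<noteq> 0 \<and> (\<forall>v. n \<bullet> v < 0 \<longrightarrow> (\<exists>\<epsilon>>0. \<forall>t. 0 < t \<and> t < \<epsilon> \<longrightarrow> p + of_real t * v \<in> chart -` E))"
  proof -
    obtain n where n: "plane n = g (chart p)" using plane_surj by blast
    have "n \<noteq> 0" using n g0 norm_plane[of n] by auto
    moreover have "\<exists>\<epsilon>>0. \<forall>t. 0 < t \<and> t < \<epsilon> \<longrightarrow> p + of_real t * v \<in> chart -` E" if "n \<bullet> v < 0" for v
    proof -
      have "g (chart p) \<bullet> plane v < 0" using that by (simp add: plane_inner flip: n)
      from sublevel_inner_cone[OF cp U d[OF U(2)] EU this]
      show ?thesis by (simp add: chart_def plane_add plane_scale add.assoc)
    qed
    ultimately show ?thesis by blast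
  qed
  fix \<epsilon> :: real assume "\<epsilon> > 0"
  from sublevel_one_sided[OF open_E cp U d g g0 EU this]
  obtain \<delta> Q where Q: "\<delta> > 0" "connected Q" "E \<inter> ball (chart p) \<delta> \<subseteq> Q" "Q \<subseteq> E \<inter> ball (chart p) \<epsilon>"
    by blast
  have ball: "ball p r = chart -` ball (chart p) r" for r by (auto simp: dist_chart)
  have "chart -` E \<inter> ball p \<delta> \<subseteq> chart -` Q" "chart -` Q \<subseteq> chart -` E \<inter> ball p \<epsilon>"
    unfolding ball using Q(3,4) by blast+
  then show "\<exists>\<delta>>0. \<exists>Q. connected Q \<and> chart -` E \<inter> ball p \<delta> \<subseteq> Q \<and> Q \<subseteq> chart -` E \<inter> ball p \<epsilon>"
    using Q(1) connected_chart[OF Q(2)] by blast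
qed

lemma four_components: "4 \<le> card (components E)"
  using views.four_le_card card_image_le[OF fin] by (rule order_trans)

end

theorem theorem4:
  fixes E :: "(real^2) set"
  assumes "open E"
    and "bounded E"
    and "smooth_boundary E"
    and "weakly_semiconvex E"
    and "\<not> semiconvex E"
  shows "\<exists>\<C>. \<C> \<subseteq> components E \<and> card \<C> = 4"
proof (cases "finite (components E)")
  case True
  obtain x where x: "x \<notin> E" "\<not> semiconvex_at E x" using assms(5) unfolding semiconvex_def by blast
  interpret plane_dark_point E x by unfold_locales (use assms x True in auto)
  show ?thesis using obtain_subset_with_card_n[OF four_components] by metis
next
  case False
  then show ?thesis using infinite_arbitrarily_large by blast
qed

end
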